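(* There is a universal constant $c>0$ such that the following holds. Let $K\subset\mathbb{R}^p$ be a convex cone with $w(K\cap\mathbb{S}^{p-1})\ge 64\sqrt{\log 3}$. Then there exists a constant $C^*(K)\le 8p$ such that for any positive integer $n$ and any $\nu>0$ satisfying $n(\nu\wedge\nu^2)=C^*(K)$, if $X_1,\dots,X_n$ are i.i.d. with $X_i\sim\mathcal{N}(0,I+\nu\bar x\bar x^\top)$, the minimax risk of estimating $\bar x\in K\cap\mathbb{S}^{p-1}$ based on $X_1,\dots,X_n$ satisfies $$\inf_{\hat v}\ \sup_{\bar x\in K\cap\mathbb{S}^{p-1}}\mathbb{E}\|\hat v-\bar x\|\ \ge\ c\,\frac{w(K\cap\mathbb{S}^{p-1})}{\log p\,(\nu\wedge\sqrt{\nu})\sqrt n},$$ where the infimum is over all estimators $\hat v=\hat v(X_1,\dots,X_n)$.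
   Context: $\|\cdot\|$ is the Euclidean norm, $\mathbb{S}^{p-1}$ the unit sphere of $\mathbb{R}^p$, $a\wedge b=\min(a,b)$. The Gaussian complexity of $T\subset\mathbb{R}^p$ is $w(T)=\mathbb{E}\sup_{t\in T}\langle g,t\rangle$ with $g\sim\mathcal{N}(0,I_p)$. The constant $C^*(K)$ is positive and depends only on $K$. *)

theory Defs
  imports
    "HOL-Probability.Probability"
    "Jordan_Normal_Form.Gauss_Jordan_Elimination"
    "Jordan_Normal_Form.Determinant"
begin

text \<open>
  The dimension \<open>p\<close> is quantified after the universal constant, so it cannot be a type: a point of
  \<open>p\<close>-dimensional Euclidean space is an extensional function on \<open>{..<p}\<close>, i.e. an element of the
  space of the product measure \<open>Pi\<^sub>M {..<p} (\<lambda>_. borel)\<close>. Its Euclidean norm is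
  \<open>L2_set x {..<p}\<close>.
\<close>

definition Rn :: "nat \<Rightarrow> (nat \<Rightarrow> real) measure" where
  "Rn p = Pi\<^sub>M {..<p} (\<lambda>_. borel)"

definition Rn_lborel :: "nat \<Rightarrow> (nat \<Rightarrow> real) measure" where
  "Rn_lborel p = Pi\<^sub>M {..<p} (\<lambda>_. lborel)"

definition unit_sphere :: "nat \<Rightarrow> (nat \<Rightarrow> real) set" where
  "unit_sphere p = {x \<in> space (Rn p). L2_set x {..<p} = 1}"

text \<open>
  Scaling is by positive factors only, so a cone may or may not contain the origin.
\<close>

definition convex_cone_Rn :: "nat \<Rightarrow> (nat \<Rightarrow> real) set \<Rightarrow> bool" where
  "convex_cone_Rn p K \<longleftrightarrow>
     K \<subseteq> space (Rn p) \<and>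
     (\<forall>x\<in>K. \<forall>y\<in>K. \<forall>u\<ge>0. \<forall>v\<ge>0. u + v = 1 \<longrightarrow> (\<lambda>i\<in>{..<p}. u * x i + v * y i) \<in> K) \<and>
     (\<forall>x\<in>K. \<forall>a>0. (\<lambda>i\<in>{..<p}. a * x i) \<in> K)"

text \<open>
  The centred Gaussian law with covariance \<open>\<Sigma>\<close>, given by its Lebesgue density; meaningful for
  symmetric positive definite \<open>\<Sigma> \<in> carrier_mat p p\<close>.
\<close>

definition mvn :: "nat \<Rightarrow> real mat \<Rightarrow> (nat \<Rightarrow> real) measure" where
  "mvn p \<Sigma> = density (Rn_lborel p)
     (\<lambda>x. ennreal (exp (- (vec p x \<bullet> (the (mat_inverse \<Sigma>) *\<^sub>v vec p x)) / 2)
                     / sqrt ((2 * pi) ^ p * Determinant.det \<Sigma>)))"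

definition spiked_cov :: "nat \<Rightarrow> real \<Rightarrow> (nat \<Rightarrow> real) \<Rightarrow> real mat" where
  "spiked_cov p \<nu> x = 1\<^sub>m p + \<nu> \<cdot>\<^sub>m mat p p (\<lambda>(i, j). x i * x j)"

text \<open>
  The supremum is a real one, so it is the intended one for bounded \<open>T\<close>. The empty set, whose real
  supremum is unspecified, gets complexity \<open>0\<close>.
\<close>

definition gaussian_complexity :: "nat \<Rightarrow> (nat \<Rightarrow> real) set \<Rightarrow> real" where
  "gaussian_complexity p T =
     (if T = {} then 0
      else (\<integral>g. (SUP t\<in>T. \<Sum>i<p. g i * t i) \<partial>mvn p (1\<^sub>m p)))"

text \<open>Joint law of the i.i.d. sample \<open>X 0, \<dots>, X (n - 1)\<close> in the spiked model.\<close>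

definition sample_law :: "nat \<Rightarrow> nat \<Rightarrow> real \<Rightarrow> (nat \<Rightarrow> real) \<Rightarrow> (nat \<Rightarrow> nat \<Rightarrow> real) measure" where
  "sample_law p n \<nu> x = Pi\<^sub>M {..<n} (\<lambda>_. mvn p (spiked_cov p \<nu> x))"

text \<open>
  All measurable functions of the sample; the values need not lie in \<open>K\<close> or on the sphere.
\<close>

definition estimators :: "nat \<Rightarrow> nat \<Rightarrow> ((nat \<Rightarrow> nat \<Rightarrow> real) \<Rightarrow> (nat \<Rightarrow> real)) set" where
  "estimators p n = measurable (Pi\<^sub>M {..<n} (\<lambda>_. Rn p)) (Rn p)"

text \<open>Risks are taken in \<^typ>\<open>ennreal\<close> because an estimator need not be integrable.\<close>

definition minimax_risk :: "nat \<Rightarrow> nat \<Rightarrow> real \<Rightarrow> (nat \<Rightarrow> real) set \<Rightarrow> ennreal" where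
  "minimax_risk p n \<nu> T =
     (INF v\<in>estimators p n. SUP x\<in>T.
        \<integral>\<^sup>+X. ennreal (L2_set (\<lambda>i. v X i - x i) {..<p}) \<partial>sample_law p n \<nu> x)"

end

theory Submission
  imports Defs
begin

text \<open>
  Since \<open>(min \<nu> (sqrt \<nu>)) * sqrt n = sqrt C\<close>, a lower bound of order \<open>w / (ln p * sqrt C)\<close> is
  wanted for one suitable \<open>C\<close>. Chaining bounds \<open>w\<close> by a sum of terms \<open>\<epsilon> * sqrt (ln N(\<epsilon>))\<close> over
  about \<open>ln p\<close> dyadic scales \<open>\<epsilon>\<close>, with \<open>N(\<epsilon>)\<close> the packing number of the spherical set, so one scale
  satisfies \<open>\<epsilon> * sqrt (ln N(\<epsilon>)) \<ge> const * w / ln p\<close>. Take \<open>C\<close> to be \<open>ln N(\<epsilon>) / 4\<close>, capped at \<open>8 * p\<close>.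
  All spiked sample laws have divergence at most \<open>C / 2\<close> from the common law \<open>N(0, I)\<close>, hence the
  points of the packing cannot be told apart, and the risk is at least of order \<open>\<epsilon>\<close>.
\<close>

text \<open>The cap \<open>8 * p\<close> does three jobs. It keeps \<open>C\<close> within the
  required bound. It ends the chain: if some scale \<epsilon> has a packing with \<open>ln N\<close>
  at least \<open>32 * p\<close> and still fails to be good, then \<epsilon>
  \<open>* sqrt (8 * p)\<close> lies below the target \<delta>, while everything left from the
  previous scale on costs at most 2 \<epsilon> \<open>* sqrt p\<close>. Until that happens
  \<open>exp (32 * p)\<close> bounds every packing, so largest packings exist and serve as nets;
  this takes the place of a volumetric count on the sphere.

  The testing step compares each spiked law with the null law on the event that the likelihood ratio
  is at most \<open>sqrt N\<close>. Disjoint events share null mass one, so the N truncated parts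
  together cost only \<open>sqrt N\<close>, and the rest is a tail governed by the divergence. This
  yields a definite error only when \<open>ln N\<close> is at least 5. Coarse scales below that
  threshold give no test, but their chaining terms form a geometric series, and its bounded sum is
  absorbed by the lower bound on \<open>w\<close>.\<close>

section \<open>Determinant and inverse of the spiked covariance\<close>

text \<open>The density in \<open>mvn\<close> applies \<open>the\<close> to
  \<open>mat_inverse\<close>, so the value inside the option must be identified. A two-sided inverse
  excludes \<open>None\<close>, and uniqueness of inverses fixes the rest.\<close>

lemma mat_inverse_eqI:
  fixes A B :: "real mat"
  assumes A: "A \<in> carrier_mat n n" and B: "B \<in> carrier_mat n n"
    and AB: "A * B = 1\<^sub>m n" and BA: "B * A = 1\<^sub>m n"
  shows "mat_inverse A = Some B"
proof (cases "mat_inverse A")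
  case None
  have "A \<in> Units (ring_mat TYPE(real) n ())"
    using A B AB BA by (auto simp: Units_def ring_mat_def)
  with mat_inverse(1)[OF A None, where b = "()"] show ?thesis by simp
next
  case (Some C)
  from mat_inverse(2)[OF A Some] have C: "A * C = 1\<^sub>m n" "C \<in> carrier_mat n n" by auto
  have "C = (B * A) * C" using BA C by simp
  also have "\<dots> = B * (A * C)" using A B C by (intro assoc_mult_mat)
  also have "\<dots> = B" using B C by simp
  finally show ?thesis using Some by simp
qed

text \<open>For a unit vector the matrix x x^T is a projection, so the matrices I + a x x^T multiply
  like the scalars 1 + a acting along x.\<close>

lemma spiked_cov_mult:
  assumes "(\<Sum>i<p. (x i)\<^sup>2) = 1"
  shows "spiked_cov p a x * spiked_cov p b x = spiked_cov p (a + b + a * b) x"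
proof -
  let ?M = "mat p p (\<lambda>(i, j). x i * x j)"
  have MM: "?M * ?M = ?M"
  proof (rule eq_matI)
    fix i j assume "i < dim_row ?M" "j < dim_col ?M"
    then have "(?M * ?M) $$ (i, j) = (\<Sum>k<p. x i * x k * (x k * x j))"
      by (simp add: scalar_prod_def atLeast0LessThan)
    also have "\<dots> = x i * x j * (\<Sum>k<p. (x k)\<^sup>2)"
      by (simp add: sum_distrib_left power2_eq_square ac_simps)
    finally show "(?M * ?M) $$ (i, j) = ?M $$ (i, j)"
      using assms \<open>i < dim_row ?M\<close> \<open>j < dim_col ?M\<close> by simp
  qed auto
  have "(1\<^sub>m p + a \<cdot>\<^sub>m ?M) * (1\<^sub>m p + b \<cdot>\<^sub>m ?M)
      = 1\<^sub>m p * (1\<^sub>m p + b \<cdot>\<^sub>m ?M) + (a \<cdot>\<^sub>m ?M) * (1\<^sub>m p + b \<cdot>\<^sub>m ?M)"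
    by (rule add_mult_distrib_mat) auto
  also have "(a \<cdot>\<^sub>m ?M) * (1\<^sub>m p + b \<cdot>\<^sub>m ?M) = (a \<cdot>\<^sub>m ?M) * 1\<^sub>m p + (a \<cdot>\<^sub>m ?M) * (b \<cdot>\<^sub>m ?M)"
    by (rule mult_add_distrib_mat) auto
  also have "(a \<cdot>\<^sub>m ?M) * (b \<cdot>\<^sub>m ?M) = a \<cdot>\<^sub>m (?M * (b \<cdot>\<^sub>m ?M))"
    by (rule mult_smult_assoc_mat) auto
  also have "?M * (b \<cdot>\<^sub>m ?M) = b \<cdot>\<^sub>m (?M * ?M)"
    by (rule mult_smult_distrib) auto
  finally have "(1\<^sub>m p + a \<cdot>\<^sub>m ?M) * (1\<^sub>m p + b \<cdot>\<^sub>m ?M)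
      = (1\<^sub>m p + b \<cdot>\<^sub>m ?M) + (a \<cdot>\<^sub>m ?M + a \<cdot>\<^sub>m (b \<cdot>\<^sub>m ?M))"
    by (simp add: MM)
  also have "\<dots> = 1\<^sub>m p + (a + b + a * b) \<cdot>\<^sub>m ?M"
    by (rule eq_matI) (auto simp: algebra_simps)
  finally show ?thesis
    by (simp add: spiked_cov_def)
qed

lemma spiked_cov_0 [simp]: "spiked_cov p 0 x = 1\<^sub>m p"
  by (rule eq_matI) (auto simp: spiked_cov_def)

text \<open>The parameter b of the inverse solves (1 + \<nu>)(1 + b) = 1, that is \<nu> + b + \<nu>
  b = 0.\<close>

lemma mat_inverse_spiked_cov:
  assumes "(\<Sum>i<p. (x i)\<^sup>2) = 1" and "\<nu> \<ge> 0"
  shows "mat_inverse (spiked_cov p \<nu> x) = Some (spiked_cov p (- \<nu> / (1 + \<nu>)) x)"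
proof (rule mat_inverse_eqI)
  have "\<nu> + (- \<nu> / (1 + \<nu>)) + \<nu> * (- \<nu> / (1 + \<nu>)) = 0"
    using \<open>\<nu> \<ge> 0\<close> by (simp add: divide_simps) (simp add: algebra_simps)
  then show "spiked_cov p \<nu> x * spiked_cov p (- \<nu> / (1 + \<nu>)) x = 1\<^sub>m p"
    and "spiked_cov p (- \<nu> / (1 + \<nu>)) x * spiked_cov p \<nu> x = 1\<^sub>m p"
    using spiked_cov_mult[OF assms(1), of \<nu> "- \<nu> / (1 + \<nu>)"]
      spiked_cov_mult[OF assms(1), of "- \<nu> / (1 + \<nu>)" \<nu>]
    by (simp_all add: algebra_simps)
qed (auto simp: spiked_cov_def)

text \<open>
  Two factorisations of the bordered matrix with blocks \<open>I\<close>, \<open>- \<nu> x\<close>, \<open>x\<^sup>T\<close>, \<open>1\<close> give the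
  determinant.
\<close>

lemma det_spiked_cov:
  "Determinant.det (spiked_cov p \<nu> x) = 1 + \<nu> * (\<Sum>i<p. (x i)\<^sup>2)"
proof -
  define c where "c = mat p 1 (\<lambda>(i, j). - \<nu> * x i)"
  define r where "r = mat 1 p (\<lambda>(i, j). x j)"
  define d where "d = mat 1 1 (\<lambda>(i, j). 1 + \<nu> * (\<Sum>i<p. (x i)\<^sup>2))"
  have carriers: "c \<in> carrier_mat p 1" "r \<in> carrier_mat 1 p" "d \<in> carrier_mat 1 1"
    "spiked_cov p \<nu> x \<in> carrier_mat p p"
    by (auto simp: c_def r_def d_def spiked_cov_def)
  have cr: "spiked_cov p \<nu> x + c * r = 1\<^sub>m p"
    by (rule eq_matI) (auto simp: c_def r_def spiked_cov_def scalar_prod_def)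
  have rc: "r * c + d = 1\<^sub>m 1"
    by (rule eq_matI)
       (auto simp: c_def r_def d_def scalar_prod_def atLeast0LessThan sum_distrib_left
         power2_eq_square mult.left_commute sum_negf)
  have "four_block_mat (1\<^sub>m p) c (0\<^sub>m 1 p) (1\<^sub>m 1) * four_block_mat (spiked_cov p \<nu> x) (0\<^sub>m p 1) r (1\<^sub>m 1)
      = four_block_mat (1\<^sub>m p * spiked_cov p \<nu> x + c * r) (1\<^sub>m p * 0\<^sub>m p 1 + c * 1\<^sub>m 1)
          (0\<^sub>m 1 p * spiked_cov p \<nu> x + 1\<^sub>m 1 * r) (0\<^sub>m 1 p * 0\<^sub>m p 1 + 1\<^sub>m 1 * 1\<^sub>m 1)"
    by (rule mult_four_block_mat[OF one_carrier_mat carriers(1) zero_carrier_mat one_carrier_mat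
          carriers(4) zero_carrier_mat carriers(2) one_carrier_mat])
  also have "\<dots> = four_block_mat (1\<^sub>m p) c r (1\<^sub>m 1)"
    using carriers by (simp only: left_mult_one_mat[OF carriers(4)] cr
        left_mult_one_mat[OF carriers(2)] right_mult_one_mat[OF carriers(1)]
        left_mult_zero_mat[OF carriers(4)]) auto
  also have "\<dots> = four_block_mat (1\<^sub>m p * 1\<^sub>m p + 0\<^sub>m p 1 * 0\<^sub>m 1 p) (1\<^sub>m p * c + 0\<^sub>m p 1 * d)
          (r * 1\<^sub>m p + 1\<^sub>m 1 * 0\<^sub>m 1 p) (r * c + 1\<^sub>m 1 * d)"
    using carriers by (simp only: left_mult_one_mat[OF carriers(1)] right_mult_one_mat[OF carriers(2)]
        left_mult_one_mat[OF carriers(3)] left_mult_zero_mat[OF carriers(3)] rc) auto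
  also have "\<dots> = four_block_mat (1\<^sub>m p) (0\<^sub>m p 1) r (1\<^sub>m 1) * four_block_mat (1\<^sub>m p) c (0\<^sub>m 1 p) d"
    by (rule mult_four_block_mat[OF one_carrier_mat zero_carrier_mat carriers(2) one_carrier_mat
          one_carrier_mat carriers(1) zero_carrier_mat carriers(3), symmetric])
  finally have "Determinant.det (four_block_mat (1\<^sub>m p) c (0\<^sub>m 1 p) (1\<^sub>m 1))
        * Determinant.det (four_block_mat (spiked_cov p \<nu> x) (0\<^sub>m p 1) r (1\<^sub>m 1))
      = Determinant.det (four_block_mat (1\<^sub>m p) (0\<^sub>m p 1) r (1\<^sub>m 1))
        * Determinant.det (four_block_mat (1\<^sub>m p) c (0\<^sub>m 1 p) d)"
    using det_mult[of "four_block_mat (1\<^sub>m p) c (0\<^sub>m 1 p) (1\<^sub>m 1)" "p + 1"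
        "four_block_mat (spiked_cov p \<nu> x) (0\<^sub>m p 1) r (1\<^sub>m 1)"]
      det_mult[of "four_block_mat (1\<^sub>m p) (0\<^sub>m p 1) r (1\<^sub>m 1)" "p + 1"
        "four_block_mat (1\<^sub>m p) c (0\<^sub>m 1 p) d"] carriers
    by (simp del: One_nat_def)
  moreover have "Determinant.det d = 1 + \<nu> * (\<Sum>i<p. (x i)\<^sup>2)"
    by (subst det_single) (auto simp: d_def)
  ultimately show ?thesis
    using carriers by (simp add: det_four_block_mat_upper_right_zero[of _ p _ 1]
        det_four_block_mat_lower_left_zero[of _ p _ 1] del: One_nat_def)
qed

lemma spiked_cov_quadratic_form:
  "vec p y \<bullet> (spiked_cov p a x *\<^sub>v vec p y) = (\<Sum>i<p. (y i)\<^sup>2) + a * (\<Sum>i<p. y i * x i)\<^sup>2"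
proof -
  have "spiked_cov p a x *\<^sub>v vec p y = vec p (\<lambda>i. y i + a * x i * (\<Sum>j<p. y j * x j))"
  proof (rule eq_vecI)
    fix i assume "i < dim_vec (vec p (\<lambda>i. y i + a * x i * (\<Sum>j<p. y j * x j)))"
    then have i: "i < p" by simp
    then have "(spiked_cov p a x *\<^sub>v vec p y) $ i
        = (\<Sum>j<p. (if i = j then 1 else 0) * y j + a * x i * (y j * x j))"
      by (auto simp: spiked_cov_def scalar_prod_def atLeast0LessThan algebra_simps intro!: sum.cong)
    also have "\<dots> = y i + a * x i * (\<Sum>j<p. y j * x j)"
      using i by (simp add: sum.distrib sum_distrib_left if_distrib[of "\<lambda>c. c * _"] cong: if_cong)
    finally show "(spiked_cov p a x *\<^sub>v vec p y) $ i
        = vec p (\<lambda>i. y i + a * x i * (\<Sum>j<p. y j * x j)) $ i"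
      using i by simp
  qed (simp add: spiked_cov_def)
  then show ?thesis
    by (simp add: scalar_prod_def atLeast0LessThan algebra_simps sum.distrib power2_eq_square
        sum_distrib_left)
qed

section \<open>Gaussian laws as product measures\<close>

text \<open>Both sides agree on rectangles, where the integral of a product of one-coordinate
  functions factorises. It serves at two levels: the coordinates of one Gaussian vector, and the
  independent draws of the sample.\<close>

lemma PiM_density:
  assumes I: "finite I"
    and M: "\<And>i. sigma_finite_measure (M i)"
    and D: "\<And>i. sigma_finite_measure (density (M i) (f i))"
    and f [measurable]: "\<And>i. f i \<in> borel_measurable (M i)"
  shows "Pi\<^sub>M I (\<lambda>i. density (M i) (f i)) = density (Pi\<^sub>M I M) (\<lambda>x. \<Prod>i\<in>I. f i (x i))"
proof -
  interpret M: product_sigma_finite M using M by (simp add: product_sigma_finite_def)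
  interpret D: product_sigma_finite "\<lambda>i. density (M i) (f i)" using D by (simp add: product_sigma_finite_def)
  have [measurable]: "(\<lambda>x. \<Prod>i\<in>I. f i (x i)) \<in> borel_measurable (Pi\<^sub>M I M)"
    using I by measurable
  show ?thesis
  proof (rule D.PiM_eqI[symmetric])
    fix A assume A: "\<And>i. i \<in> I \<Longrightarrow> A i \<in> sets (density (M i) (f i))"
    then have A': "\<And>i. i \<in> I \<Longrightarrow> A i \<in> sets (M i)" by simp
    have [measurable]: "Pi\<^sub>E I A \<in> sets (Pi\<^sub>M I M)"
      using A' I by (intro sets_PiM_I_finite)
    have "emeasure (density (Pi\<^sub>M I M) (\<lambda>x. \<Prod>i\<in>I. f i (x i))) (Pi\<^sub>E I A)
        = (\<integral>\<^sup>+x. (\<Prod>i\<in>I. f i (x i)) * indicator (Pi\<^sub>E I A) x \<partial>Pi\<^sub>M I M)"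
      by (rule emeasure_density) measurable
    also have "\<dots> = (\<integral>\<^sup>+x. (\<Prod>i\<in>I. f i (x i) * indicator (A i) (x i)) \<partial>Pi\<^sub>M I M)"
    proof (rule nn_integral_cong)
      fix x assume "x \<in> space (Pi\<^sub>M I M)"
      then have "(indicator (Pi\<^sub>E I A) x :: ennreal) = (\<Prod>i\<in>I. indicator (A i) (x i))"
        using I by (auto simp: indicator_def space_PiM PiE_iff)
      then show "(\<Prod>i\<in>I. f i (x i)) * indicator (Pi\<^sub>E I A) x
          = (\<Prod>i\<in>I. f i (x i) * indicator (A i) (x i))"
        by (simp add: prod.distrib)
    qed
    also have "\<dots> = (\<Prod>i\<in>I. \<integral>\<^sup>+x. f i x * indicator (A i) x \<partial>M i)"
      using A' I by (intro M.product_nn_integral_prod) auto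
    also have "\<dots> = (\<Prod>i\<in>I. emeasure (density (M i) (f i)) (A i))"
      using A' by (intro prod.cong refl) (simp add: emeasure_density)
    finally show "emeasure (density (Pi\<^sub>M I M) (\<lambda>x. \<Prod>i\<in>I. f i (x i))) (Pi\<^sub>E I A)
        = (\<Prod>i\<in>I. emeasure (density (M i) (f i)) (A i))" .
  qed (use I in \<open>auto intro!: sets_PiM_cong\<close>)
qed

lemma has_bochner_integral_distrD:
  fixes f :: "'a \<Rightarrow> 'b::{banach, second_countable_topology}"
  assumes "has_bochner_integral (distr M N g) f c"
    and "f \<in> borel_measurable N" and "g \<in> measurable M N"
  shows "has_bochner_integral M (\<lambda>x. f (g x)) c"
  using assms by (simp add: has_bochner_integral_iff integrable_distr_eq integral_distr)

lemma has_bochner_integral_real_densityI: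
  fixes f g :: "'a \<Rightarrow> real"
  assumes "has_bochner_integral M (\<lambda>x. g x * f x) c"
    and "f \<in> borel_measurable M" and "g \<in> borel_measurable M" and "\<And>x. 0 \<le> g x"
  shows "has_bochner_integral (density M (\<lambda>x. ennreal (g x))) f c"
  using assms by (simp add: has_bochner_integral_density)

text \<open>Built from one-dimensional normals, so that independence of the coordinates is at hand;
  \<open>mvn_one\<close> identifies it with the Gaussian law of the problem statement. It is the
  reference law for all spiked ones.\<close>

definition std_gaussian :: "nat \<Rightarrow> (nat \<Rightarrow> real) measure" where
  "std_gaussian p = Pi\<^sub>M {..<p} (\<lambda>_. density lborel std_normal_density)"

lemma prob_space_std_normal: "prob_space (density lborel std_normal_density)"
  by (rule prob_space_normal_density) simp

lemma prob_space_std_gaussian: "prob_space (std_gaussian p)"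
  unfolding std_gaussian_def by (intro prob_space_PiM prob_space_std_normal)

lemma sets_std_gaussian [measurable_cong]: "sets (std_gaussian p) = sets (Rn p)"
  unfolding std_gaussian_def Rn_def by (intro sets_PiM_cong) auto

lemma space_std_gaussian: "space (std_gaussian p) = space (Rn p)"
  by (rule sets_eq_imp_space_eq[OF sets_std_gaussian])

lemma measurable_Rn_component [measurable]:
  "i < p \<Longrightarrow> (\<lambda>x. x i) \<in> borel_measurable (Rn p)"
  unfolding Rn_def by simp

lemma measurable_Rn_inner [measurable]:
  "(\<lambda>y. \<Sum>i<p. y i * x i) \<in> borel_measurable (Rn p)"
  by (rule borel_measurable_sum) (auto intro!: borel_measurable_times)

lemma std_gaussian_density:
  "std_gaussian p = density (Rn_lborel p) (\<lambda>y. ennreal (exp (- (\<Sum>i<p. (y i)\<^sup>2) / 2) / sqrt ((2 * pi) ^ p)))"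
proof -
  have "std_gaussian p
      = density (Rn_lborel p) (\<lambda>y. \<Prod>i<p. ennreal (std_normal_density (y i)))"
    unfolding std_gaussian_def Rn_lborel_def
    by (rule PiM_density)
       (auto intro!: prob_space_imp_sigma_finite prob_space_std_normal sigma_finite_lborel)
  also have "(\<lambda>y. \<Prod>i<p. ennreal (std_normal_density (y i)))
      = (\<lambda>y. ennreal (exp (- (\<Sum>i<p. (y i)\<^sup>2) / 2) / sqrt ((2 * pi) ^ p)))"
  proof
    fix y :: "nat \<Rightarrow> real"
    have "(\<Prod>i<p. std_normal_density (y i))
        = (\<Prod>i<p. exp (- (y i)\<^sup>2 / 2)) / sqrt (2 * pi) ^ p"
      by (simp add: std_normal_density_def prod_dividef)
    also have "(\<Prod>i<p. exp (- (y i)\<^sup>2 / 2)) = exp (- (\<Sum>i<p. (y i)\<^sup>2) / 2)"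
      by (simp add: exp_sum[symmetric] sum_negf sum_divide_distrib)
    also have "sqrt (2 * pi) ^ p = sqrt ((2 * pi) ^ p)"
      by (rule real_sqrt_power[symmetric])
    finally show "(\<Prod>i<p. ennreal (std_normal_density (y i)))
        = ennreal (exp (- (\<Sum>i<p. (y i)\<^sup>2) / 2) / sqrt ((2 * pi) ^ p))"
      by (simp add: prod_ennreal)
  qed
  finally show ?thesis .
qed

text \<open>The quadratic form splits into the squared norm, which is absorbed by the standard
  Gaussian density, and a rank-one term. Speaking of the inverse of \<Sigma> covers the identity
  (\<open>a = 0\<close>) and the spiked covariance at once.\<close>

lemma mvn_eq_density_std_gaussian:
  assumes "mat_inverse \<Sigma> = Some (spiked_cov p a x)" and "Determinant.det \<Sigma> > 0"
  shows "mvn p \<Sigma> = density (std_gaussian p)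
    (\<lambda>y. ennreal (exp (- a * (\<Sum>i<p. y i * x i)\<^sup>2 / 2) / sqrt (Determinant.det \<Sigma>)))"
proof -
  have sets: "sets (Rn_lborel p) = sets (Rn p)"
    unfolding Rn_lborel_def Rn_def by (intro sets_PiM_cong) auto
  note [measurable_cong] = sets
  have "density (std_gaussian p)
      (\<lambda>y. ennreal (exp (- a * (\<Sum>i<p. y i * x i)\<^sup>2 / 2) / sqrt (Determinant.det \<Sigma>)))
    = density (Rn_lborel p) (\<lambda>y. ennreal (exp (- (\<Sum>i<p. (y i)\<^sup>2) / 2) / sqrt ((2 * pi) ^ p)) *
        ennreal (exp (- a * (\<Sum>i<p. y i * x i)\<^sup>2 / 2) / sqrt (Determinant.det \<Sigma>)))"
    unfolding std_gaussian_density by (rule density_density_eq) measurable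
  also have "\<dots> = mvn p \<Sigma>"
  proof -
    have "exp (- (S + a * q) / 2) = exp (- S / 2) * exp (- a * q / 2)" for S q :: real
      by (simp add: add_divide_distrib diff_divide_distrib flip: exp_add)
    then have "ennreal (exp (- S / 2) / sqrt ((2 * pi) ^ p)) * ennreal (exp (- a * q / 2) / sqrt D)
        = ennreal (exp (- (S + a * q) / 2) / sqrt ((2 * pi) ^ p * D))" if "D > 0" for S q D :: real
      using that by (subst ennreal_mult[symmetric]) (simp_all only: real_sqrt_mult times_divide_times_eq, auto)
    then show ?thesis
      unfolding mvn_def assms(1) option.sel spiked_cov_quadratic_form using assms(2) by simp
  qed
  finally show ?thesis ..
qed

lemma mvn_one: "mvn p (1\<^sub>m p) = std_gaussian p"
proof -
  have "mat_inverse (1\<^sub>m p) = Some (spiked_cov p 0 x)" for x :: "nat \<Rightarrow> real"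
    by (rule mat_inverse_eqI) auto
  from mvn_eq_density_std_gaussian[OF this] show ?thesis
    by (simp add: density_1)
qed

text \<open>The likelihood ratio of N(0, 1 + \<nu>) against N(0, 1) at the point z. The ratio of the
  p-dimensional laws is this function of the projection onto the spike, so later integrals become
  one-dimensional.\<close>

definition spike_ratio :: "real \<Rightarrow> real \<Rightarrow> real" where
  "spike_ratio \<nu> z = exp (\<nu> * z\<^sup>2 / (2 * (1 + \<nu>))) / sqrt (1 + \<nu>)"

lemma measurable_spike_ratio [measurable]: "spike_ratio \<nu> \<in> borel_measurable borel"
  unfolding spike_ratio_def[abs_def] by measurable

lemma spike_ratio_pos: "0 \<le> \<nu> \<Longrightarrow> 0 < spike_ratio \<nu> z"
  by (simp add: spike_ratio_def)

lemma spike_ratio_std_normal: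
  assumes "0 \<le> \<nu>"
  shows "std_normal_density z * spike_ratio \<nu> z = normal_density 0 (sqrt (1 + \<nu>)) z"
proof -
  have "- z\<^sup>2 / 2 + \<nu> * z\<^sup>2 / (2 * (1 + \<nu>)) = - z\<^sup>2 / (2 * (1 + \<nu>))"
    using assms by (simp add: divide_simps) (simp add: algebra_simps)
  then have "exp (- z\<^sup>2 / 2) * exp (\<nu> * z\<^sup>2 / (2 * (1 + \<nu>))) = exp (- z\<^sup>2 / (2 * (1 + \<nu>)))"
    unfolding exp_add[symmetric] by (rule arg_cong)
  moreover have "std_normal_density z * spike_ratio \<nu> z
      = (exp (- z\<^sup>2 / 2) * exp (\<nu> * z\<^sup>2 / (2 * (1 + \<nu>)))) / (sqrt (2 * pi) * sqrt (1 + \<nu>))"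
    by (simp add: std_normal_density_def spike_ratio_def)
  ultimately show ?thesis
    using assms by (simp add: normal_density_def real_sqrt_mult)
qed

lemma mvn_spiked_cov:
  assumes "(\<Sum>i<p. (x i)\<^sup>2) = 1" and "0 \<le> \<nu>"
  shows "mvn p (spiked_cov p \<nu> x)
    = density (std_gaussian p) (\<lambda>y. ennreal (spike_ratio \<nu> (\<Sum>i<p. y i * x i)))"
proof -
  have det: "Determinant.det (spiked_cov p \<nu> x) = 1 + \<nu>"
    unfolding det_spiked_cov assms(1) by simp
  have "- (- \<nu> / (1 + \<nu>)) * q / 2 = \<nu> * q / (2 * (1 + \<nu>))" for q :: real
    by simp
  then show ?thesis
    using mvn_eq_density_std_gaussian[OF mat_inverse_spiked_cov[OF assms]] \<open>0 \<le> \<nu>\<close>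
    unfolding det spike_ratio_def by (simp only: )
qed

section \<open>One-dimensional projections of Gaussian vectors\<close>

lemma distributed_std_gaussian_component:
  assumes "i < p"
  shows "distributed (std_gaussian p) lborel (\<lambda>y. y i) std_normal_density"
proof -
  have "distr (std_gaussian p) lborel (\<lambda>y. y i)
      = distr (std_gaussian p) (density lborel std_normal_density) (\<lambda>y. y i)"
    by (rule distr_cong) auto
  also have "\<dots> = density lborel std_normal_density"
    unfolding std_gaussian_def using assms prob_space_std_normal by (intro distr_PiM_component) auto
  finally show ?thesis
    using assms by (simp add: distributed_def)
qed

text \<open>The tuple of all coordinates is the identity map, so its law is the product of the
  marginals, which characterises independence for a nonempty index set.\<close>

lemma indep_vars_std_gaussian:
  "prob_space.indep_vars (std_gaussian p) (\<lambda>_. borel) (\<lambda>i y. y i) {..<p}"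
proof -
  interpret prob_space "std_gaussian p" by (rule prob_space_std_gaussian)
  show ?thesis
  proof (cases "p = 0")
    case True
    then show ?thesis unfolding indep_vars_def indep_sets_def by simp
  next
    case False
    have "distr (std_gaussian p) (Pi\<^sub>M {..<p} (\<lambda>_. borel)) (\<lambda>y. \<lambda>i\<in>{..<p}. y i)
        = distr (std_gaussian p) (std_gaussian p) (\<lambda>y. y)"
    proof (rule distr_cong)
      fix y assume "y \<in> space (std_gaussian p)"
      then show "(\<lambda>i\<in>{..<p}. y i) = y"
        by (simp add: space_std_gaussian Rn_def space_PiM PiE_restrict)
    qed (simp_all add: sets_std_gaussian Rn_def)
    also have "\<dots> = std_gaussian p" by simp
    also have "\<dots> = (\<Pi>\<^sub>M i\<in>{..<p}. distr (std_gaussian p) borel (\<lambda>y. y i))"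
      unfolding std_gaussian_def[of p] 
    proof (rule PiM_cong)
      fix i assume "i \<in> {..<p}"
      then show "density lborel std_normal_density
          = distr (Pi\<^sub>M {..<p} (\<lambda>_. density lborel std_normal_density)) borel (\<lambda>y. y i)"
        using distributed_distr_eq_density[OF distributed_std_gaussian_component[of i p]]
        unfolding std_gaussian_def
        by (simp cong: distr_cong)
    qed simp
    finally show ?thesis
      using False by (subst indep_vars_iff_distr_eq_PiM') auto
  qed
qed

lemma distributed_std_gaussian_inner:
  assumes "(\<Sum>i<p. (x i)\<^sup>2) = 1"
  shows "distributed (std_gaussian p) lborel (\<lambda>y. \<Sum>i<p. y i * x i) std_normal_density"
proof -
  interpret prob_space "std_gaussian p" by (rule prob_space_std_gaussian)
  \<comment> \<open>A zero coefficient would give a degenerate normal of deviation zero, outside the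
    scope of \<open>sum_indep_normal\<close>; such coordinates are dropped without changing either
    sum.\<close>
  define I where "I = {i\<in>{..<p}. x i \<noteq> 0}"
  have sum_I: "(\<Sum>i\<in>I. f i) = (\<Sum>i<p. f i)" if "\<And>i. x i = 0 \<Longrightarrow> f i = 0" for f :: "nat \<Rightarrow> real"
    unfolding I_def by (rule sum.mono_neutral_left) (auto simp: that)
  have "(\<Sum>i\<in>I. (x i)\<^sup>2) = 1"
    unfolding assms[symmetric] by (rule sum_I) simp
  then have "I \<noteq> {}" by auto
  have "indep_vars (\<lambda>_. borel) (\<lambda>i y. y i * x i) I"
    using indep_vars_subset[OF indep_vars_std_gaussian, of I]
    by (rule indep_vars_compose2[where M' = "\<lambda>_. borel" and X = "\<lambda>i y. y i"]) (auto simp: I_def)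
  moreover have "distributed (std_gaussian p) lborel (\<lambda>y. y i * x i) (normal_density 0 \<bar>x i\<bar>)"
    if "i \<in> I" for i
    using normal_density_affine[OF distributed_std_gaussian_component[of i p], of "x i" 0] that
    by (simp add: I_def mult.commute)
  ultimately have "distributed (std_gaussian p) lborel (\<lambda>y. \<Sum>i\<in>I. y i * x i)
      (normal_density (\<Sum>i\<in>I. 0) (sqrt (\<Sum>i\<in>I. \<bar>x i\<bar>\<^sup>2)))"
    using \<open>I \<noteq> {}\<close> by (intro sum_indep_normal) (auto simp: I_def)
  moreover have "(\<lambda>y. \<Sum>i\<in>I. y i * x i) = (\<lambda>y. \<Sum>i<p. y i * x i)"
    by (intro ext sum_I) simp
  moreover have "(\<Sum>i\<in>I. \<bar>x i\<bar>\<^sup>2) = 1"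
    using \<open>(\<Sum>i\<in>I. (x i)\<^sup>2) = 1\<close> by simp
  ultimately show ?thesis by simp
qed

text \<open>As \<open>mvn\<close> is a mere density, its total mass has to be computed. Along the
  projection onto the spike it is the mass of N(0, 1 + \<nu>).\<close>

lemma prob_space_spiked:
  assumes x: "(\<Sum>i<p. (x i)\<^sup>2) = 1" and "0 \<le> \<nu>"
  shows "prob_space (mvn p (spiked_cov p \<nu> x))"
proof
  have "emeasure (mvn p (spiked_cov p \<nu> x)) (space (mvn p (spiked_cov p \<nu> x)))
      = (\<integral>\<^sup>+y. ennreal (spike_ratio \<nu> (\<Sum>i<p. y i * x i)) \<partial>std_gaussian p)"
    unfolding mvn_spiked_cov[OF assms] by (subst emeasure_density) (auto intro!: nn_integral_cong)
  also have "\<dots> = (\<integral>\<^sup>+z. ennreal (std_normal_density z) * ennreal (spike_ratio \<nu> z) \<partial>lborel)"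
    by (rule distributed_nn_integral[OF distributed_std_gaussian_inner[OF x], symmetric]) simp
  also have "\<dots> = (\<integral>\<^sup>+z. ennreal (normal_density 0 (sqrt (1 + \<nu>)) z) \<partial>lborel)"
    using \<open>0 \<le> \<nu>\<close> by (simp add: spike_ratio_std_normal spike_ratio_pos less_imp_le flip: ennreal_mult)
  also have "\<dots> = 1"
    using \<open>0 \<le> \<nu>\<close> by (subst nn_integral_eq_integral) (auto simp: normal_density_nonneg)
  finally show "emeasure (mvn p (spiked_cov p \<nu> x)) (space (mvn p (spiked_cov p \<nu> x))) = 1" .
qed

lemma spiked_second_moment:
  assumes x: "(\<Sum>i<p. (x i)\<^sup>2) = 1" and "0 \<le> \<nu>"
  shows "has_bochner_integral (mvn p (spiked_cov p \<nu> x)) (\<lambda>y. (\<Sum>i<p. y i * x i)\<^sup>2) (1 + \<nu>)"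
proof -
  have "fact (2 * 1) / ((2 / (sqrt (1 + \<nu>))\<^sup>2) ^ 1 * fact 1) = 1 + \<nu>"
    using \<open>0 \<le> \<nu>\<close> by (simp add: fact_2)
  then have "has_bochner_integral lborel (\<lambda>z. normal_density 0 (sqrt (1 + \<nu>)) z * z\<^sup>2) (1 + \<nu>)"
    using normal_moment_even[of "sqrt (1 + \<nu>)" 0 1] \<open>0 \<le> \<nu>\<close> by (simp only: diff_0_right mult_1_right) simp
  then have "has_bochner_integral lborel
      (\<lambda>z. std_normal_density z * (spike_ratio \<nu> z * z\<^sup>2)) (1 + \<nu>)"
    using \<open>0 \<le> \<nu>\<close> by (simp add: spike_ratio_std_normal flip: mult.assoc)
  then have "has_bochner_integral (density lborel std_normal_density)
      (\<lambda>z. spike_ratio \<nu> z * z\<^sup>2) (1 + \<nu>)"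
    by (rule has_bochner_integral_real_densityI) auto
  then have "has_bochner_integral (distr (std_gaussian p) lborel (\<lambda>y. \<Sum>i<p. y i * x i))
      (\<lambda>z. spike_ratio \<nu> z * z\<^sup>2) (1 + \<nu>)"
    by (simp add: distributed_distr_eq_density[OF distributed_std_gaussian_inner[OF x]])
  then have "has_bochner_integral (std_gaussian p)
      (\<lambda>y. spike_ratio \<nu> (\<Sum>i<p. y i * x i) * (\<Sum>i<p. y i * x i)\<^sup>2) (1 + \<nu>)"
    by (rule has_bochner_integral_distrD) auto
  then show ?thesis
    unfolding mvn_spiked_cov[OF assms] using \<open>0 \<le> \<nu>\<close>
    by (intro has_bochner_integral_real_densityI) (auto simp: spike_ratio_pos less_imp_le)
qed

section \<open>Exponential moments, means and variances under the standard Gaussian\<close>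

lemma nn_integral_exp_std_normal:
  "(\<integral>\<^sup>+z. ennreal (exp (a * z)) \<partial>density lborel std_normal_density) = ennreal (exp (a\<^sup>2 / 2))"
proof -
  have "std_normal_density z * exp (a * z) = exp (a\<^sup>2 / 2) * normal_density a 1 z" for z
    by (simp add: normal_density_def field_simps power2_diff flip: exp_add)
  then have "(\<integral>\<^sup>+z. ennreal (exp (a * z)) \<partial>density lborel std_normal_density)
      = (\<integral>\<^sup>+z. ennreal (exp (a\<^sup>2 / 2)) * ennreal (normal_density a 1 z) \<partial>lborel)"
    by (subst nn_integral_density) (auto simp flip: ennreal_mult)
  also have "\<dots> = ennreal (exp (a\<^sup>2 / 2)) * (\<integral>\<^sup>+z. ennreal (normal_density a 1 z) \<partial>lborel)"
    by (rule nn_integral_cmult) simp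
  also have "(\<integral>\<^sup>+z. ennreal (normal_density a 1 z) \<partial>lborel) = 1"
    by (subst nn_integral_eq_integral) (auto simp: normal_density_nonneg)
  finally show ?thesis by simp
qed

text \<open>The exponential of the sum factorises over the coordinates, which treats vectors
  \<open>d\<close> of any length, zero included; chaining increments need this.\<close>

lemma exp_inner_std_gaussian:
  "has_bochner_integral (std_gaussian p) (\<lambda>g. exp (\<Sum>i<p. g i * d i)) (exp ((\<Sum>i<p. (d i)\<^sup>2) / 2))"
proof (rule has_bochner_integral_nn_integral)
  interpret product_sigma_finite "\<lambda>_::nat. density lborel std_normal_density"
    using prob_space_imp_sigma_finite[OF prob_space_std_normal] by (simp add: product_sigma_finite_def)
  have "(\<integral>\<^sup>+g. ennreal (exp (\<Sum>i<p. g i * d i)) \<partial>std_gaussian p)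
      = (\<integral>\<^sup>+g. (\<Prod>i<p. ennreal (exp (d i * g i))) \<partial>std_gaussian p)"
    by (simp add: exp_sum prod_ennreal mult.commute)
  also have "\<dots> = (\<Prod>i<p. ennreal (exp ((d i)\<^sup>2 / 2)))"
    unfolding std_gaussian_def
    by (subst product_nn_integral_prod) (auto simp: nn_integral_exp_std_normal)
  also have "\<dots> = ennreal (exp ((\<Sum>i<p. (d i)\<^sup>2) / 2))"
    by (simp add: prod_ennreal exp_sum sum_divide_distrib)
  finally show "(\<integral>\<^sup>+g. ennreal (exp (\<Sum>i<p. g i * d i)) \<partial>std_gaussian p)
      = ennreal (exp ((\<Sum>i<p. (d i)\<^sup>2) / 2))" .
qed auto

lemma std_gaussian_component_moments:
  assumes "i < p"
  shows "has_bochner_integral (std_gaussian p) (\<lambda>g. g i) 0"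
    and "has_bochner_integral (std_gaussian p) (\<lambda>g. (g i)\<^sup>2) 1"
proof -
  have *: "has_bochner_integral (std_gaussian p) (\<lambda>g. f (g i)) c"
    if "has_bochner_integral lborel (\<lambda>z. std_normal_density z * f z) c"
      and [measurable]: "f \<in> borel_measurable borel" for f :: "real \<Rightarrow> real" and c
  proof -
    have "has_bochner_integral (density lborel std_normal_density) f c"
      using that(1) by (rule has_bochner_integral_real_densityI) auto
    then have "has_bochner_integral (distr (std_gaussian p) lborel (\<lambda>y. y i)) f c"
      by (simp add: distributed_distr_eq_density[OF distributed_std_gaussian_component[OF assms]])
    then show ?thesis
      by (rule has_bochner_integral_distrD) (use assms in auto)
  qed
  show "has_bochner_integral (std_gaussian p) (\<lambda>g. g i) 0"
    by (rule *) (use std_normal_moment_odd[of 0] in simp_all)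
  show "has_bochner_integral (std_gaussian p) (\<lambda>g. (g i)\<^sup>2) 1"
    by (rule *) (use std_normal_moment_even[of 1] in \<open>simp_all add: fact_2\<close>)
qed

lemma std_gaussian_inner_mean:
  "has_bochner_integral (std_gaussian p) (\<lambda>g. \<Sum>i<p. g i * d i) 0"
proof -
  have "has_bochner_integral (std_gaussian p) (\<lambda>g. \<Sum>i<p. g i * d i) (\<Sum>i<p. 0 * d i)"
    by (intro has_bochner_integral_sum has_bochner_integral_mult_left
        std_gaussian_component_moments) simp
  then show ?thesis by simp
qed

section \<open>Chaining\<close>

lemma integrable_Max:
  fixes f :: "'i \<Rightarrow> 'a \<Rightarrow> real"
  assumes "finite S" and "S \<noteq> {}" and f: "\<And>s. s \<in> S \<Longrightarrow> integrable M (f s)"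
  shows "integrable M (\<lambda>x. Max ((\<lambda>s. f s x) ` S))"
proof (rule Bochner_Integration.integrable_bound)
  show "integrable M (\<lambda>x. \<Sum>s\<in>S. \<bar>f s x\<bar>)"
    using f by auto
  show "(\<lambda>x. Max ((\<lambda>s. f s x) ` S)) \<in> borel_measurable M"
    using assms by (intro borel_measurable_Max) auto
  have "\<bar>Max ((\<lambda>s. f s x) ` S)\<bar> \<le> (\<Sum>s\<in>S. \<bar>f s x\<bar>)" for x
  proof -
    have "Max ((\<lambda>s. f s x) ` S) \<in> (\<lambda>s. f s x) ` S"
      using assms by (intro Max_in) auto
    then obtain s where "s \<in> S" "Max ((\<lambda>s. f s x) ` S) = f s x" by blast
    then show ?thesis
      using \<open>finite S\<close> member_le_sum[of s S "\<lambda>s. \<bar>f s x\<bar>"] by simp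
  qed
  then show "AE x in M. norm (Max ((\<lambda>s. f s x) ` S)) \<le> norm (\<Sum>s\<in>S. \<bar>f s x\<bar>)"
    by (intro AE_I2) (smt (verit) real_norm_def)
qed

lemma integrable_std_gaussian_Max:
  assumes "finite S" and "S \<noteq> {}"
  shows "integrable (std_gaussian p) (\<lambda>g. Max ((\<lambda>s. \<Sum>i<p. g i * d s i) ` S))"
  using assms by (intro integrable_Max) (auto intro: integrable.intros[OF std_gaussian_inner_mean])

text \<open>The exponential of \<open>l\<close> times the maximum is at most the sum of the
  exponentials. The bound \<open>B\<close> replaces the logarithm of the cardinality so that it
  stays positive for a singleton.\<close>

lemma std_gaussian_Max_le:
  fixes d :: "'s \<Rightarrow> nat \<Rightarrow> real"
  assumes S: "finite S" "S \<noteq> {}" and B: "ln (real (card S)) \<le> B" "0 < B"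
    and "0 < \<sigma>" and d: "\<And>s. s \<in> S \<Longrightarrow> L2_set (d s) {..<p} \<le> \<sigma>"
  shows "(\<integral>g. Max ((\<lambda>s. \<Sum>i<p. g i * d s i) ` S) \<partial>std_gaussian p) \<le> \<sigma> * sqrt (2 * B)"
proof -
  interpret prob_space "std_gaussian p" by (rule prob_space_std_gaussian)
  define M where "M g = Max ((\<lambda>s. \<Sum>i<p. g i * d s i) ` S)" for g
  \<comment> \<open>This choice balances B / l against l \<sigma>^2 / 2. Each exponential moment is
    then at most \<open>exp B\<close>, and their sum at most \<open>exp (2 * B)\<close>.\<close>
  define l where "l = sqrt (2 * B) / \<sigma>"
  have "0 < l" using \<open>0 < \<sigma>\<close> \<open>0 < B\<close> by (simp add: l_def)
  have l2: "l\<^sup>2 * \<sigma>\<^sup>2 = 2 * B"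
    using \<open>0 < \<sigma>\<close> \<open>0 < B\<close> by (simp add: l_def power_divide)
  have int: "integrable (std_gaussian p) M"
    unfolding M_def using S by (rule integrable_std_gaussian_Max)
  have exp_int: "has_bochner_integral (std_gaussian p) (\<lambda>g. exp (\<Sum>i<p. g i * (l * d s i)))
      (exp ((\<Sum>i<p. (l * d s i)\<^sup>2) / 2))" for s
    by (rule exp_inner_std_gaussian)
  have exp_le: "exp ((\<Sum>i<p. (l * d s i)\<^sup>2) / 2) \<le> exp B" if "s \<in> S" for s
  proof -
    have "(\<Sum>i<p. (l * d s i)\<^sup>2) = l\<^sup>2 * (L2_set (d s) {..<p})\<^sup>2"
      by (simp add: L2_set_def sum_nonneg power_mult_distrib sum_distrib_left)
    also have "\<dots> \<le> l\<^sup>2 * \<sigma>\<^sup>2"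
      using d[OF that] by (intro mult_left_mono power_mono) auto
    finally show ?thesis using l2 by simp
  qed
  text \<open>The tangent line of \<open>exp\<close> at \<open>2 * B\<close> takes the place of Jensen's inequality.\<close>
  have "l * M g \<le> exp (- 2 * B) * (\<Sum>s\<in>S. exp (\<Sum>i<p. g i * (l * d s i))) + (2 * B - 1)" for g
  proof -
    have "M g \<in> (\<lambda>s. \<Sum>i<p. g i * d s i) ` S"
      unfolding M_def using S by (intro Max_in) auto
    then obtain s where s: "s \<in> S" "M g = (\<Sum>i<p. g i * d s i)" by blast
    have "1 + (l * M g - 2 * B) \<le> exp (l * M g - 2 * B)"
      by (rule exp_ge_add_one_self)
    also have "\<dots> = exp (- 2 * B) * exp (l * M g)"
      by (simp flip: exp_add)
    also have "exp (l * M g) = exp (\<Sum>i<p. g i * (l * d s i))"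
      by (simp add: s sum_distrib_left mult.left_commute)
    also have "\<dots> \<le> (\<Sum>s\<in>S. exp (\<Sum>i<p. g i * (l * d s i)))"
      using S s by (intro member_le_sum) auto
    finally show ?thesis by simp
  qed
  then have "(\<integral>g. l * M g \<partial>std_gaussian p) \<le>
      (\<integral>g. exp (- 2 * B) * (\<Sum>s\<in>S. exp (\<Sum>i<p. g i * (l * d s i))) + (2 * B - 1) \<partial>std_gaussian p)"
    using int integrable.intros[OF exp_int] by (intro integral_mono) auto
  also have "\<dots> = exp (- 2 * B) * (\<Sum>s\<in>S. exp ((\<Sum>i<p. (l * d s i)\<^sup>2) / 2)) + (2 * B - 1)"
    using integrable.intros[OF exp_int] prob_space
    by (simp add: has_bochner_integral_integral_eq[OF exp_int])
  also have "(\<Sum>s\<in>S. exp ((\<Sum>i<p. (l * d s i)\<^sup>2) / 2)) \<le> real (card S) * exp B"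
    using sum_bounded_above[of S "\<lambda>s. exp ((\<Sum>i<p. (l * d s i)\<^sup>2) / 2)" "exp B"] exp_le by simp
  also have "real (card S) \<le> exp B"
    using S B by (metis card_gt_0_iff exp_le_cancel_iff exp_ln of_nat_0_less_iff)
  also have "exp (- 2 * B) * (exp B * exp B) + (2 * B - 1) = 2 * B"
    by (simp flip: exp_add)
  finally have "l * (\<integral>g. M g \<partial>std_gaussian p) \<le> 2 * B"
    by simp
  then have "(\<integral>g. M g \<partial>std_gaussian p) \<le> 2 * B / l"
    using \<open>0 < l\<close> by (simp add: field_simps)
  also have "\<dots> = \<sigma> * sqrt (2 * B)"
    using \<open>0 < B\<close> \<open>0 < \<sigma>\<close> by (simp add: l_def real_div_sqrt field_simps)
  finally show ?thesis by (simp add: M_def)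
qed

text \<open>The arithmetic-geometric mean inequality with weight \<open>sqrt p\<close> bounds the
  norm by an affine function of its square, whose mean is \<open>p\<close>. This gives integrability
  and the estimate together.\<close>

lemma std_gaussian_norm:
  assumes "0 < p"
  shows "integrable (std_gaussian p) (\<lambda>g. L2_set g {..<p})"
    and "(\<integral>g. L2_set g {..<p} \<partial>std_gaussian p) \<le> sqrt p"
proof -
  interpret prob_space "std_gaussian p" by (rule prob_space_std_gaussian)
  have sq: "has_bochner_integral (std_gaussian p) (\<lambda>g. \<Sum>i<p. (g i)\<^sup>2) (\<Sum>i<p. 1)"
    by (rule has_bochner_integral_sum) (auto intro: std_gaussian_component_moments)
  have int: "integrable (std_gaussian p) (\<lambda>g. ((\<Sum>i<p. (g i)\<^sup>2) / sqrt p + sqrt p) / 2)"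
    using integrable.intros[OF sq] by auto
  have le: "L2_set g {..<p} \<le> ((\<Sum>i<p. (g i)\<^sup>2) / sqrt p + sqrt p) / 2" for g
  proof -
    have "L2_set g {..<p} * sqrt p * 2 \<le> (L2_set g {..<p})\<^sup>2 + (sqrt p)\<^sup>2"
      using sum_squares_bound[of "L2_set g {..<p}" "sqrt p"] by simp
    then have "L2_set g {..<p} * sqrt p * 2 \<le> (\<Sum>i<p. (g i)\<^sup>2) + sqrt p * sqrt p"
      by (simp add: L2_set_def sum_nonneg)
    then show ?thesis using assms by (simp add: field_simps)
  qed
  have [measurable]: "(\<lambda>g. L2_set g {..<p}) \<in> borel_measurable (std_gaussian p)"
    unfolding L2_set_def by measurable
  show norm_int: "integrable (std_gaussian p) (\<lambda>g. L2_set g {..<p})"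
    by (rule Bochner_Integration.integrable_bound[OF int]) (use le in \<open>auto intro!: AE_I2 order_trans[OF _ abs_ge_self]\<close>)
  have "(\<integral>g. L2_set g {..<p} \<partial>std_gaussian p)
      \<le> (\<integral>g. ((\<Sum>i<p. (g i)\<^sup>2) / sqrt p + sqrt p) / 2 \<partial>std_gaussian p)"
    using norm_int int le by (intro integral_mono) auto
  also have "\<dots> = (p / sqrt p + sqrt p) / 2"
    using integrable.intros[OF sq] prob_space
    by (simp add: has_bochner_integral_integral_eq[OF sq])
  also have "\<dots> = sqrt p" by (simp add: real_div_sqrt)
  finally show "(\<integral>g. L2_set g {..<p} \<partial>std_gaussian p) \<le> sqrt p" .
qed

lemma inner_diff_le:
  fixes g s t :: "nat \<Rightarrow> real"
  shows "(\<Sum>i<p. g i * t i) \<le> (\<Sum>i<p. g i * s i) + L2_set g {..<p} * L2_set (\<lambda>i. t i - s i) {..<p}"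
proof -
  have "(\<Sum>i<p. g i * t i) - (\<Sum>i<p. g i * s i) = (\<Sum>i<p. g i * (t i - s i))"
    by (simp add: algebra_simps sum_subtractf)
  also have "\<dots> \<le> (\<Sum>i<p. \<bar>g i\<bar> * \<bar>t i - s i\<bar>)"
    by (intro sum_mono) (simp flip: abs_mult)
  also have "\<dots> \<le> L2_set g {..<p} * L2_set (\<lambda>i. t i - s i) {..<p}"
    by (rule L2_set_mult_ineq)
  finally show ?thesis by simp
qed

text \<open>Gaussian complexity of a finite nonempty set, with a maximum in place of the supremum,
  so that measurability and integrability are automatic along the chain.\<close>

definition finite_width :: "nat \<Rightarrow> (nat \<Rightarrow> real) set \<Rightarrow> real" where
  "finite_width p S = (\<integral>g. Max ((\<lambda>s. \<Sum>i<p. g i * s i) ` S) \<partial>std_gaussian p)"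

text \<open>One link of the chain: each point of the finer set is its nearby point in
  \<open>S\<close> plus an increment. The nearby point is a function of \<open>t\<close>, so there
  are at most \<open>card S'\<close> increments, and only that cardinality enters.\<close>

lemma finite_width_refine:
  assumes S: "finite S" "S \<noteq> {}" and S': "finite S'" "S' \<noteq> {}"
    and net: "\<And>t. t \<in> S' \<Longrightarrow> \<exists>s\<in>S. L2_set (\<lambda>i. t i - s i) {..<p} \<le> \<epsilon>"
    and "0 < \<epsilon>" and B: "ln (real (card S')) \<le> B" "0 < B"
  shows "finite_width p S' \<le> finite_width p S + \<epsilon> * sqrt (2 * B)"
proof -
  from net obtain \<pi> where \<pi>: "\<And>t. t \<in> S' \<Longrightarrow> \<pi> t \<in> S"
      "\<And>t. t \<in> S' \<Longrightarrow> L2_set (\<lambda>i. t i - \<pi> t i) {..<p} \<le> \<epsilon>"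
    by metis
  let ?A = "\<lambda>g. Max ((\<lambda>s. \<Sum>i<p. g i * s i) ` S)"
  let ?D = "\<lambda>g. Max ((\<lambda>t. \<Sum>i<p. g i * (t i - \<pi> t i)) ` S')"
  have int: "integrable (std_gaussian p) ?A" "integrable (std_gaussian p) ?D"
      "integrable (std_gaussian p) (\<lambda>g. Max ((\<lambda>s. \<Sum>i<p. g i * s i) ` S'))"
    using S S' by (simp_all add: integrable_std_gaussian_Max)
  have "Max ((\<lambda>s. \<Sum>i<p. g i * s i) ` S') \<le> ?A g + ?D g" for g
  proof (rule Max.boundedI)
    fix a assume "a \<in> (\<lambda>s. \<Sum>i<p. g i * s i) ` S'"
    then obtain t where t: "t \<in> S'" "a = (\<Sum>i<p. g i * t i)" by blast
    have "a = (\<Sum>i<p. g i * \<pi> t i) + (\<Sum>i<p. g i * (t i - \<pi> t i))"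
      by (simp add: t algebra_simps sum_subtractf)
    also have "\<dots> \<le> ?A g + ?D g"
      using S S' t \<pi> by (intro add_mono Max_ge) auto
    finally show "a \<le> ?A g + ?D g" .
  qed (use S' in auto)
  then have "finite_width p S' \<le> (\<integral>g. ?A g + ?D g \<partial>std_gaussian p)"
    unfolding finite_width_def using int by (intro integral_mono) auto
  also have "\<dots> = finite_width p S + (\<integral>g. ?D g \<partial>std_gaussian p)"
    unfolding finite_width_def using int by simp
  also have "(\<integral>g. ?D g \<partial>std_gaussian p) \<le> \<epsilon> * sqrt (2 * B)"
    using S' B \<open>0 < \<epsilon>\<close> \<pi>(2) by (intro std_gaussian_Max_le) auto
  finally show ?thesis by simp
qed

text \<open>The closing link: below the last net Cauchy-Schwarz bounds all increments at once by
  \<epsilon> times the norm of \<open>g\<close>.\<close>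

lemma gaussian_complexity_le_net:
  assumes S: "finite S" "S \<noteq> {}" and "T \<noteq> {}" and "0 < p"
    and net: "\<And>t. t \<in> T \<Longrightarrow> \<exists>s\<in>S. L2_set (\<lambda>i. t i - s i) {..<p} \<le> \<epsilon>"
    and pos: "0 < gaussian_complexity p T"
  shows "gaussian_complexity p T \<le> finite_width p S + \<epsilon> * sqrt p"
proof -
  let ?A = "\<lambda>g. Max ((\<lambda>s. \<Sum>i<p. g i * s i) ` S)"
  let ?T = "\<lambda>g. SUP t\<in>T. \<Sum>i<p. g i * t i"
  have w: "gaussian_complexity p T = (\<integral>g. ?T g \<partial>std_gaussian p)"
    using \<open>T \<noteq> {}\<close> by (simp add: gaussian_complexity_def mvn_one)
  \<comment> \<open>The integral of a non-integrable function is 0 by convention, so positivity of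
    the complexity yields integrability of a supremum over a possibly uncountable set.\<close>
  then have int: "integrable (std_gaussian p) ?T"
    using pos not_integrable_integral_eq by fastforce
  have intA: "integrable (std_gaussian p) ?A"
    using S by (rule integrable_std_gaussian_Max)
  have "0 \<le> \<epsilon>"
    using net \<open>T \<noteq> {}\<close> by (meson L2_set_nonneg ex_in_conv order_trans)
  have "?T g \<le> ?A g + \<epsilon> * L2_set g {..<p}" for g
  proof (rule cSUP_least[OF \<open>T \<noteq> {}\<close>])
    fix t assume "t \<in> T"
    with net obtain s where s: "s \<in> S" "L2_set (\<lambda>i. t i - s i) {..<p} \<le> \<epsilon>" by blast
    have "(\<Sum>i<p. g i * t i)
        \<le> (\<Sum>i<p. g i * s i) + L2_set g {..<p} * L2_set (\<lambda>i. t i - s i) {..<p}"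
      by (rule inner_diff_le)
    also have "\<dots> \<le> ?A g + L2_set g {..<p} * \<epsilon>"
      using S s by (intro add_mono Max_ge mult_left_mono) auto
    finally show "(\<Sum>i<p. g i * t i) \<le> ?A g + \<epsilon> * L2_set g {..<p}"
      by (simp add: mult.commute)
  qed
  then have "gaussian_complexity p T \<le> (\<integral>g. ?A g + \<epsilon> * L2_set g {..<p} \<partial>std_gaussian p)"
    unfolding w using int intA std_gaussian_norm[OF \<open>0 < p\<close>] by (intro integral_mono) auto
  also have "\<dots> = finite_width p S + \<epsilon> * (\<integral>g. L2_set g {..<p} \<partial>std_gaussian p)"
    unfolding finite_width_def using intA std_gaussian_norm[OF \<open>0 < p\<close>] by simp
  also have "\<dots> \<le> finite_width p S + \<epsilon> * sqrt p"
    using std_gaussian_norm[OF \<open>0 < p\<close>] \<open>0 \<le> \<epsilon>\<close> by (intro add_mono mult_left_mono) auto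
  finally show ?thesis .
qed

section \<open>Packings, and the nets obtained from largest packings\<close>

definition separated :: "nat \<Rightarrow> real \<Rightarrow> (nat \<Rightarrow> real) set \<Rightarrow> bool" where
  "separated p \<epsilon> S \<longleftrightarrow> (\<forall>x\<in>S. \<forall>y\<in>S. x \<noteq> y \<longrightarrow> \<epsilon> \<le> L2_set (\<lambda>i. x i - y i) {..<p})"

text \<open>A point farther than \<epsilon> from a largest packing could be added to it. The bound
  \<open>m\<close> secures that a largest one exists.\<close>

lemma maximal_separated_net:
  assumes "T \<noteq> {}" and "0 \<le> \<epsilon>"
    and bound: "\<And>S. \<lbrakk>finite S; S \<subseteq> T; separated p \<epsilon> S\<rbrakk> \<Longrightarrow> card S \<le> m"
  obtains S where "finite S" "S \<noteq> {}" "S \<subseteq> T" "separated p \<epsilon> S"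
    "\<And>t. t \<in> T \<Longrightarrow> \<exists>s\<in>S. L2_set (\<lambda>i. t i - s i) {..<p} \<le> \<epsilon>"
proof -
  let ?P = "\<lambda>S. finite S \<and> S \<subseteq> T \<and> separated p \<epsilon> S"
  obtain S where S: "?P S" and max: "\<And>S'. ?P S' \<Longrightarrow> card S' \<le> card S"
  proof -
    have "?P {}" by (simp add: separated_def)
    moreover have "\<forall>S. ?P S \<longrightarrow> card S < Suc m" using bound by (simp add: less_Suc_eq_le)
    ultimately show ?thesis
      using ex_has_greatest_nat[of ?P "{}" card "Suc m"] that by blast
  qed
  have net: "\<exists>s\<in>S. L2_set (\<lambda>i. t i - s i) {..<p} \<le> \<epsilon>" if "t \<in> T" for t
  proof (rule ccontr)
    assume far: "\<not> ?thesis"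
    then have "t \<notin> S" using \<open>0 \<le> \<epsilon>\<close> by (auto simp: L2_set_def)
    have "L2_set (\<lambda>i. s i - t i) {..<p} = L2_set (\<lambda>i. t i - s i) {..<p}" for s
      by (simp add: L2_set_def power2_commute)
    then have "?P (insert t S)"
      using S far \<open>t \<in> T\<close> by (auto simp: separated_def)
    from max[OF this] show False
      using S \<open>t \<notin> S\<close> by simp
  qed
  then have "S \<noteq> {}" using \<open>T \<noteq> {}\<close> by blast
  with S net that show thesis by blast
qed

text \<open>
  Chaining along nets of radius \<open>2 / 2 ^ k\<close>. Scales whose packings have fewer than \<open>exp 5\<close> points
  contribute at most \<open>13\<close> altogether, and the chain is broken off at the first scale with a
  packing of more than \<open>exp (32 * p)\<close> points.
\<close>

lemma gaussian_complexity_le_packing: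
  assumes "0 < p" and "0 < \<delta>"
    and T: "T \<noteq> {}" "\<And>t. t \<in> T \<Longrightarrow> L2_set t {..<p} \<le> 1"
    and pos: "0 < gaussian_complexity p T"
    and packing: "\<And>k S. \<lbrakk>k \<le> L; finite S; S \<subseteq> T; separated p (2 / 2 ^ k) S; 5 \<le> ln (card S)\<rbrakk>
      \<Longrightarrow> 2 / 2 ^ k * sqrt (min (ln (card S) / 4) (8 * p)) < \<delta>"
  shows "gaussian_complexity p T \<le> 13 + 6 * real L * \<delta> + 2 * \<delta> + 2 / 2 ^ L * sqrt p"
proof -
  define \<epsilon> :: "nat \<Rightarrow> real" where "\<epsilon> k = 2 / 2 ^ k" for k
  have \<epsilon>: "0 < \<epsilon> k" "\<epsilon> k = 2 * \<epsilon> (Suc k)" for k by (auto simp: \<epsilon>_def)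
  define w where "w = gaussian_complexity p T"
  \<comment> \<open>Either the final bound is already established, or a net of radius
    \<open>\<epsilon> k\<close> is at hand. The term \<open>13 / 4 * (4 - 2 * \<epsilon> k)\<close>
    starts at 0 and grows by \<open>13 / 4 * \<epsilon> k\<close> per step, because the radii halve;
    it never exceeds 13.\<close>
  have chain: "w \<le> 13 + 6 * real k * \<delta> + 2 * \<delta> \<or>
      (\<exists>S. finite S \<and> S \<noteq> {} \<and> S \<subseteq> T
        \<and> (\<forall>t\<in>T. \<exists>s\<in>S. L2_set (\<lambda>i. t i - s i) {..<p} \<le> \<epsilon> k)
        \<and> finite_width p S \<le> 13 / 4 * (4 - 2 * \<epsilon> k) + 6 * real k * \<delta>)" if "k \<le> L" for k
    using that
  proof (induction k)
    case 0
    obtain t where "t \<in> T" using T by blast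
    have "L2_set (\<lambda>i. s i - t i) {..<p} \<le> \<epsilon> 0" if "s \<in> T" for s
    proof -
      have "L2_set (\<lambda>i. - t i) {..<p} = L2_set t {..<p}" by (simp add: L2_set_def)
      then show ?thesis
        using L2_set_triangle_ineq[of s "\<lambda>i. - t i" "{..<p}"] T(2)[OF that] T(2)[OF \<open>t \<in> T\<close>]
        by (simp add: \<epsilon>_def)
    qed
    moreover have "finite_width p {t} = 0"
      by (simp add: finite_width_def has_bochner_integral_integral_eq[OF std_gaussian_inner_mean])
    ultimately show ?case
      using \<open>t \<in> T\<close> by (intro disjI2 exI[of _ "{t}"]) (simp add: \<epsilon>_def)
  next
    case (Suc k)
    have "6 * real k * \<delta> \<le> 6 * real (Suc k) * \<delta>"
      using \<open>0 < \<delta>\<close> by simp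
    consider (stopped) "w \<le> 13 + 6 * real k * \<delta> + 2 * \<delta>"
      | (open_chain) S where "finite S" "S \<noteq> {}" "S \<subseteq> T"
          "\<And>t. t \<in> T \<Longrightarrow> \<exists>s\<in>S. L2_set (\<lambda>i. t i - s i) {..<p} \<le> \<epsilon> k"
          "finite_width p S \<le> 13 / 4 * (4 - 2 * \<epsilon> k) + 6 * real k * \<delta>"
      using Suc by auto
    then show ?case
    proof cases
      case stopped
      then show ?thesis using \<open>6 * real k * \<delta> \<le> 6 * real (Suc k) * \<delta>\<close> by linarith
    next
      case open_chain
      \<comment> \<open>If the next scale has a packing with logarithm at least
        \<open>32 * p\<close>, the cap is the active term in \<open>packing\<close>, so
        \<open>\<epsilon> k * sqrt p\<close> is at most \<open>2 * \<delta>\<close> and the chain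
        stops. Otherwise all packings at that scale are bounded in size and a largest one extends
        the chain.\<close>
      show ?thesis
      proof (cases "\<exists>S'. finite S' \<and> S' \<subseteq> T \<and> separated p (\<epsilon> (Suc k)) S' \<and> 32 * real p \<le> ln (card S')")
        case True
        then obtain S' where S': "finite S'" "S' \<subseteq> T" "separated p (\<epsilon> (Suc k)) S'" "32 * real p \<le> ln (card S')"
          by blast
        have "5 \<le> ln (card S')" using S'(4) \<open>0 < p\<close> by linarith
        with packing[of "Suc k" S'] S' Suc.prems have "\<epsilon> (Suc k) * sqrt (min (ln (card S') / 4) (8 * p)) < \<delta>"
          by (simp add: \<epsilon>_def)
        then have "\<epsilon> (Suc k) * sqrt (8 * p) < \<delta>"
          using S'(4) by (simp add: min_absorb2)
        moreover have "\<epsilon> (Suc k) * sqrt p \<le> \<epsilon> (Suc k) * sqrt (8 * p)"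
          using \<epsilon>(1)[of "Suc k"] by (intro mult_left_mono real_sqrt_le_mono) auto
        ultimately have "2 * (\<epsilon> (Suc k) * sqrt p) \<le> 2 * \<delta>" by linarith
        then have "\<epsilon> k * sqrt p \<le> 2 * \<delta>" by (simp only: \<epsilon>(2)[of k] mult.assoc)
        moreover have "w \<le> finite_width p S + \<epsilon> k * sqrt p"
          unfolding w_def using open_chain T \<open>0 < p\<close> pos by (intro gaussian_complexity_le_net) auto
        ultimately show ?thesis
          using open_chain(5) \<epsilon>(1)[of k] \<open>0 < \<delta>\<close>
          by (intro disjI1) (simp add: algebra_simps)
      next
        case False
        have bound: "card S' \<le> nat \<lceil>exp (32 * real p)\<rceil>"
          if "finite S'" "S' \<subseteq> T" "separated p (\<epsilon> (Suc k)) S'" for S'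
        proof (cases "card S' = 0")
          case nonempty: False
          with False that have "ln (real (card S')) \<le> 32 * real p" by force
          with nonempty have "real (card S') \<le> exp (32 * real p)"
            by (metis exp_le_cancel_iff exp_ln gr0I of_nat_0_less_iff)
          then show ?thesis by linarith
        qed simp
        obtain S' where S': "finite S'" "S' \<noteq> {}" "S' \<subseteq> T" "separated p (\<epsilon> (Suc k)) S'"
            and net: "\<And>t. t \<in> T \<Longrightarrow> \<exists>s\<in>S'. L2_set (\<lambda>i. t i - s i) {..<p} \<le> \<epsilon> (Suc k)"
          using maximal_separated_net[OF T(1) less_imp_le[OF \<epsilon>(1)] bound] by blast
        let ?B = "max 5 (ln (card S'))"
        have step: "finite_width p S' \<le> finite_width p S + \<epsilon> k * sqrt (2 * ?B)"
          using open_chain S' \<epsilon>(1) by (intro finite_width_refine) (auto simp: subset_iff)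
        \<comment> \<open>For large packings, 2 ln N = 8 (ln N / 4) and \<open>sqrt 8\<close> is at
          most 3; halving the radius doubles this to 6. For small ones \<open>?B\<close> is 5, and
          \<open>13 / 4\<close> exceeds \<open>sqrt 10\<close>.\<close>
        have "\<epsilon> k * sqrt (2 * ?B) \<le> 13 / 4 * \<epsilon> k + 6 * \<delta>"
        proof (cases "5 \<le> ln (card S')")
          case True
          have "ln (card S') \<le> 32 * real p" using False S' by force
          then have "min (ln (card S') / 4) (8 * p) = ln (card S') / 4" by simp
          with packing[of "Suc k" S'] S' Suc.prems True have "\<epsilon> (Suc k) * sqrt (ln (card S') / 4) < \<delta>"
            by (simp add: \<epsilon>_def)
          moreover have "sqrt (2 * ?B) \<le> 3 * sqrt (ln (card S') / 4)"
            using True by (intro real_le_lsqrt) (auto simp: power_mult_distrib)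
          then have "\<epsilon> k * sqrt (2 * ?B) \<le> \<epsilon> k * (3 * sqrt (ln (card S') / 4))"
            using \<epsilon>(1)[of k] by (intro mult_left_mono) auto
          moreover have "\<epsilon> k * (3 * sqrt (ln (card S') / 4)) = 6 * (\<epsilon> (Suc k) * sqrt (ln (card S') / 4))"
            by (simp add: \<epsilon>(2)[of k])
          ultimately show ?thesis using \<epsilon>(1)[of k] by linarith
        next
          case small: False
          have "sqrt (2 * ?B) \<le> 13 / 4"
            using small by (intro real_le_lsqrt) (auto simp: power2_eq_square)
          then have "\<epsilon> k * sqrt (2 * ?B) \<le> \<epsilon> k * (13 / 4)"
            using \<epsilon>(1)[of k] by (intro mult_left_mono) auto
          then show ?thesis using \<open>0 < \<delta>\<close> by simp
        qed
        with step open_chain(5) \<epsilon>(2)[of k]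
        have "finite_width p S' \<le> 13 / 4 * (4 - 2 * \<epsilon> (Suc k)) + 6 * real (Suc k) * \<delta>"
          by (simp add: algebra_simps)
        with S' net show ?thesis by blast
      qed
    qed
  qed
  from chain[OF order_refl] show ?thesis
  proof (elim disjE exE conjE)
    assume "w \<le> 13 + 6 * real L * \<delta> + 2 * \<delta>"
    moreover have "0 \<le> 2 / 2 ^ L * sqrt p" by simp
    ultimately show ?thesis unfolding w_def by linarith
  next
    fix S assume S: "finite S" "S \<noteq> {}" "S \<subseteq> T"
        "\<forall>t\<in>T. \<exists>s\<in>S. L2_set (\<lambda>i. t i - s i) {..<p} \<le> \<epsilon> L"
        "finite_width p S \<le> 13 / 4 * (4 - 2 * \<epsilon> L) + 6 * real L * \<delta>"
    have "w \<le> finite_width p S + \<epsilon> L * sqrt p"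
      unfolding w_def using S T \<open>0 < p\<close> pos by (intro gaussian_complexity_le_net) auto
    with S(5) \<epsilon>(1)[of L] \<open>0 < \<delta>\<close> show ?thesis
      unfolding w_def[symmetric] \<epsilon>_def[symmetric] by (simp add: algebra_simps)
  qed
qed

section \<open>Testing among the points of a packing\<close>

lemma sets_mvn: "sets (mvn p \<Sigma>) = sets (Rn p)"
  unfolding mvn_def Rn_lborel_def Rn_def by (simp cong: sets_PiM_cong)

text \<open>Likelihood ratio of the whole sample against the sample without a spike, one factor for
  each draw.\<close>

definition sample_ratio :: "nat \<Rightarrow> nat \<Rightarrow> real \<Rightarrow> (nat \<Rightarrow> real) \<Rightarrow> (nat \<Rightarrow> nat \<Rightarrow> real) \<Rightarrow> real" where
  "sample_ratio p n \<nu> x X = (\<Prod>j<n. spike_ratio \<nu> (\<Sum>i<p. X j i * x i))"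

definition null_sample_law :: "nat \<Rightarrow> nat \<Rightarrow> (nat \<Rightarrow> nat \<Rightarrow> real) measure" where
  "null_sample_law p n = Pi\<^sub>M {..<n} (\<lambda>_. std_gaussian p)"

lemma prob_space_null_sample_law: "prob_space (null_sample_law p n)"
  unfolding null_sample_law_def by (intro prob_space_PiM prob_space_std_gaussian)

lemma sets_null_sample_law: "sets (null_sample_law p n) = sets (Pi\<^sub>M {..<n} (\<lambda>_. Rn p))"
  unfolding null_sample_law_def by (intro sets_PiM_cong) (auto simp: sets_std_gaussian)

lemma measurable_sample_ratio:
  "sample_ratio p n \<nu> x \<in> borel_measurable (null_sample_law p n)"
proof -
  have "(\<lambda>X. \<Sum>i<p. X j i * x i) \<in> borel_measurable (null_sample_law p n)" if "j < n" for j
    using that unfolding null_sample_law_def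
    by (intro measurable_compose[OF measurable_component_singleton[of j] , where g = "\<lambda>y. \<Sum>i<p. y i * x i"])
       (auto simp: measurable_cong_sets[OF sets_std_gaussian])
  then show ?thesis
    unfolding sample_ratio_def[abs_def]
    by (intro borel_measurable_prod) (auto intro: measurable_compose[OF _ measurable_spike_ratio])
qed

lemma sample_ratio_pos: "0 \<le> \<nu> \<Longrightarrow> 0 < sample_ratio p n \<nu> x X"
  by (auto simp: sample_ratio_def spike_ratio_pos intro!: prod_pos)

section \<open>Sample laws: density, divergence and tail of the likelihood ratio\<close>

lemma sample_law_eq_density:
  assumes "(\<Sum>i<p. (x i)\<^sup>2) = 1" and "0 \<le> \<nu>"
  shows "sample_law p n \<nu> x = density (null_sample_law p n) (\<lambda>X. ennreal (sample_ratio p n \<nu> x X))"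
proof -
  have [measurable]: "(\<lambda>y. spike_ratio \<nu> (\<Sum>i<p. y i * x i)) \<in> borel_measurable (std_gaussian p)"
    by measurable
  show ?thesis
    unfolding sample_law_def mvn_spiked_cov[OF assms] null_sample_law_def
    using prob_space_spiked[OF assms] assms(2)
    by (subst PiM_density)
       (auto intro!: prob_space_imp_sigma_finite prob_space_std_gaussian
         simp: mvn_spiked_cov[OF assms] sample_ratio_def prod_ennreal spike_ratio_pos less_imp_le)
qed

lemma prob_space_sample_law:
  assumes "(\<Sum>i<p. (x i)\<^sup>2) = 1" and "0 \<le> \<nu>"
  shows "prob_space (sample_law p n \<nu> x)"
  unfolding sample_law_def by (intro prob_space_PiM prob_space_spiked assms)

text \<open>The logarithm of one factor is affine in the squared projection, whose mean under the
  spiked law is 1 + \<nu>. The divergence is therefore known exactly.\<close>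

lemma log_sample_ratio_mean:
  assumes x: "(\<Sum>i<p. (x i)\<^sup>2) = 1" and "0 \<le> \<nu>"
  shows "has_bochner_integral (sample_law p n \<nu> x) (\<lambda>X. ln (sample_ratio p n \<nu> x X))
    (n * (\<nu> - ln (1 + \<nu>)) / 2)"
proof -
  interpret S: prob_space "sample_law p n \<nu> x" by (rule prob_space_sample_law[OF assms])
  let ?P = "mvn p (spiked_cov p \<nu> x)"
  let ?z = "\<lambda>X j. \<Sum>i<p. X j i * x i"
  have sq: "has_bochner_integral (sample_law p n \<nu> x) (\<lambda>X. (?z X j)\<^sup>2) (1 + \<nu>)" if "j < n" for j
  proof -
    have "distr (sample_law p n \<nu> x) ?P (\<lambda>X. X j) = ?P"
      unfolding sample_law_def using that prob_space_spiked[OF assms]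
      by (intro distr_PiM_component) auto
    then have "has_bochner_integral (distr (sample_law p n \<nu> x) ?P (\<lambda>X. X j))
        (\<lambda>y. (\<Sum>i<p. y i * x i)\<^sup>2) (1 + \<nu>)"
      using spiked_second_moment[OF assms] by simp
    then show ?thesis
      by (rule has_bochner_integral_distrD)
         (use that in \<open>auto simp: sample_law_def measurable_cong_sets[OF sets_mvn]\<close>)
  qed
  have ln: "ln (spike_ratio \<nu> z) = \<nu> / (2 * (1 + \<nu>)) * z\<^sup>2 - ln (1 + \<nu>) / 2" for z
    using \<open>0 \<le> \<nu>\<close> by (simp add: spike_ratio_def ln_div ln_sqrt)
  have const: "has_bochner_integral (sample_law p n \<nu> x) (\<lambda>X. ln (1 + \<nu>) / 2) (ln (1 + \<nu>) / 2)"
    using S.prob_space by (simp add: has_bochner_integral_iff)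
  have "has_bochner_integral (sample_law p n \<nu> x)
      (\<lambda>X. \<Sum>j<n. \<nu> / (2 * (1 + \<nu>)) * (?z X j)\<^sup>2 - ln (1 + \<nu>) / 2)
      (\<Sum>j<n. \<nu> / (2 * (1 + \<nu>)) * (1 + \<nu>) - ln (1 + \<nu>) / 2)"
    using sq const
    by (intro has_bochner_integral_sum has_bochner_integral_diff has_bochner_integral_mult_right) auto
  moreover have "(\<Sum>j<n. \<nu> / (2 * (1 + \<nu>)) * (1 + \<nu>) - ln (1 + \<nu>) / 2) = n * (\<nu> - ln (1 + \<nu>)) / 2"
    using \<open>0 \<le> \<nu>\<close> by (simp add: field_simps)
  moreover have "ln (sample_ratio p n \<nu> x X) = (\<Sum>j<n. \<nu> / (2 * (1 + \<nu>)) * (?z X j)\<^sup>2 - ln (1 + \<nu>) / 2)" for X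
    unfolding sample_ratio_def using \<open>0 \<le> \<nu>\<close>
    by (subst ln_prod) (auto simp: less_imp_neq[OF spike_ratio_pos, symmetric] ln simp del: sum_subtractf)
  ultimately show ?thesis by (simp only:)
qed

lemma inverse_sample_ratio_mean:
  assumes x: "(\<Sum>i<p. (x i)\<^sup>2) = 1" and "0 \<le> \<nu>"
  shows "has_bochner_integral (sample_law p n \<nu> x) (\<lambda>X. 1 / sample_ratio p n \<nu> x X) 1"
proof -
  interpret Q: prob_space "null_sample_law p n" by (rule prob_space_null_sample_law)
  have "sample_ratio p n \<nu> x X * (1 / sample_ratio p n \<nu> x X) = 1" for X
    using sample_ratio_pos[OF \<open>0 \<le> \<nu>\<close>, of p n x X] by simp
  then have "has_bochner_integral (null_sample_law p n)
      (\<lambda>X. sample_ratio p n \<nu> x X * (1 / sample_ratio p n \<nu> x X)) 1"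
    using Q.prob_space by (simp add: has_bochner_integral_iff)
  then show ?thesis
    unfolding sample_law_eq_density[OF assms]
    by (rule has_bochner_integral_real_densityI)
       (use measurable_sample_ratio sample_ratio_pos[OF \<open>0 \<le> \<nu>\<close>] in \<open>auto simp: less_imp_le\<close>)
qed

text \<open>Links the divergence to the normalisation of the theorem: twice the divergence per draw
  is at most \<open>min \<nu> (\<nu>\<^sup>2)\<close>. The quadratic bound on the logarithm serves
  small \<nu>, its nonnegativity large \<nu>.\<close>

lemma diff_ln_le_min_square:
  fixes \<nu> :: real
  assumes "0 < \<nu>"
  shows "\<nu> - ln (1 + \<nu>) \<le> min \<nu> (\<nu>\<^sup>2)"
proof (cases "\<nu> \<le> 1")
  case True
  then show ?thesis
    using ln_one_plus_pos_lower_bound[of \<nu>] ln_ge_zero[of "1 + \<nu>"] assms by simp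
next
  case False
  then have "\<nu> \<le> \<nu>\<^sup>2" using assms by (simp add: power2_eq_square)
  then show ?thesis using ln_ge_zero[of "1 + \<nu>"] assms by simp
qed

text \<open>
  Markov's inequality for the positive part of the log-likelihood ratio, whose mean under the
  alternative is the Kullback--Leibler divergence; the negative part is controlled by the inverse
  ratio, which has mean one.
\<close>

lemma sample_ratio_tail:
  assumes x: "(\<Sum>i<p. (x i)\<^sup>2) = 1" and "0 < \<nu>" and "1 < \<tau>"
  shows "measure (sample_law p n \<nu> x) {X \<in> space (sample_law p n \<nu> x). \<tau> < sample_ratio p n \<nu> x X}
    \<le> (n * min \<nu> (\<nu>\<^sup>2) / 2 + 1) / ln \<tau>"
proof -
  let ?P = "sample_law p n \<nu> x" and ?F = "sample_ratio p n \<nu> x"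
  let ?E = "{X \<in> space ?P. \<tau> < ?F X}"
  have "0 \<le> \<nu>" using assms by simp
  interpret P: prob_space ?P by (rule prob_space_sample_law[OF x \<open>0 \<le> \<nu>\<close>])
  have F [measurable]: "?F \<in> borel_measurable ?P"
    using measurable_sample_ratio sample_law_eq_density[OF x \<open>0 \<le> \<nu>\<close>, of n] by simp
  have E [measurable]: "?E \<in> sets ?P" by measurable
  note mean = log_sample_ratio_mean[OF x \<open>0 \<le> \<nu>\<close>, of n] inverse_sample_ratio_mean[OF x \<open>0 \<le> \<nu>\<close>, of n]
  have le: "ln \<tau> * indicator ?E X \<le> ln (?F X) + 1 / ?F X" for X
  proof -
    have pos: "0 < ?F X" using \<open>0 \<le> \<nu>\<close> by (rule sample_ratio_pos)
    have "ln (1 / ?F X) \<le> 1 / ?F X - 1" using pos by (intro ln_le_minus_one) simp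
    then have "0 \<le> ln (?F X) + 1 / ?F X" using pos by (simp add: ln_div)
    moreover have "ln \<tau> \<le> ln (?F X) + 1 / ?F X" if "\<tau> < ?F X"
    proof -
      have "ln \<tau> \<le> ln (?F X)" using that \<open>1 < \<tau>\<close> by simp
      moreover have "0 \<le> 1 / ?F X" using pos by simp
      ultimately show ?thesis by linarith
    qed
    ultimately show ?thesis by (auto simp: indicator_def)
  qed
  have "ln \<tau> * measure ?P ?E = (\<integral>X. ln \<tau> * indicator ?E X \<partial>?P)"
    using E by simp
  also have "\<dots> \<le> (\<integral>X. ln (?F X) + 1 / ?F X \<partial>?P)"
  proof (rule integral_mono[OF _ _ le])
    show "integrable ?P (\<lambda>X. ln \<tau> * indicator ?E X)"
      using E by (auto intro!: integrable_mult_right integrable_real_indicator simp: P.emeasure_eq_measure)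
    show "integrable ?P (\<lambda>X. ln (?F X) + 1 / ?F X)"
      using mean by (intro Bochner_Integration.integrable_add) (auto intro: integrable.intros)
  qed
  also have "\<dots> = n * (\<nu> - ln (1 + \<nu>)) / 2 + 1"
    using has_bochner_integral_integral_eq[OF has_bochner_integral_add[OF mean]] .
  also have "\<dots> \<le> n * min \<nu> (\<nu>\<^sup>2) / 2 + 1"
    using diff_ln_le_min_square[OF \<open>0 < \<nu>\<close>] by (intro add_mono divide_right_mono mult_left_mono) auto
  finally show ?thesis
    using \<open>1 < \<tau>\<close> by (simp add: field_simps)
qed

text \<open>Where the ratio is at most \<tau>, the spiked law is at most \<tau> times the null law;
  the remaining part of \<open>A\<close> lies in the tail event.\<close>

lemma sample_law_change_of_measure:
  assumes x: "(\<Sum>i<p. (x i)\<^sup>2) = 1" and "0 < \<nu>" and "1 < \<tau>"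
    and A: "A \<in> sets (null_sample_law p n)"
  shows "measure (sample_law p n \<nu> x) A
    \<le> \<tau> * measure (null_sample_law p n) A + (n * min \<nu> (\<nu>\<^sup>2) / 2 + 1) / ln \<tau>"
proof -
  let ?P = "sample_law p n \<nu> x" and ?F = "sample_ratio p n \<nu> x" and ?Q = "null_sample_law p n"
  have "0 \<le> \<nu>" using assms by simp
  interpret P: prob_space ?P by (rule prob_space_sample_law[OF x \<open>0 \<le> \<nu>\<close>])
  interpret Q: prob_space ?Q by (rule prob_space_null_sample_law)
  note P_eq = sample_law_eq_density[OF x \<open>0 \<le> \<nu>\<close>, of n]
  have F [measurable]: "?F \<in> borel_measurable ?Q" by (rule measurable_sample_ratio)
  let ?E = "{X \<in> space ?P. \<tau> < ?F X}"
  let ?G = "A \<inter> {X \<in> space ?Q. ?F X \<le> \<tau>}"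
  have sets: "sets ?P = sets ?Q" and space: "space ?P = space ?Q" by (simp_all add: P_eq)
  have G: "?G \<in> sets ?Q" using A by measurable
  have E: "?E \<in> sets ?P" unfolding sets space by measurable
  have "emeasure ?P ?G = (\<integral>\<^sup>+X. ennreal (?F X) * indicator ?G X \<partial>?Q)"
    unfolding P_eq using G by (intro emeasure_density) auto
  also have "\<dots> \<le> (\<integral>\<^sup>+X. ennreal \<tau> * indicator A X \<partial>?Q)"
    by (intro nn_integral_mono) (auto simp: indicator_def intro: ennreal_leI)
  also have "\<dots> = ennreal \<tau> * emeasure ?Q A"
    using A by (rule nn_integral_cmult_indicator)
  finally have "measure ?P ?G \<le> \<tau> * measure ?Q A"
    using \<open>1 < \<tau>\<close> by (simp add: P.emeasure_eq_measure Q.emeasure_eq_measure flip: ennreal_mult)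
  moreover have "measure ?P A \<le> measure ?P (?G \<union> ?E)"
    using sets.sets_into_space[OF A] A G E
    by (intro P.finite_measure_mono) (auto simp: sets space)
  moreover have "measure ?P (?G \<union> ?E) \<le> measure ?P ?G + measure ?P ?E"
    using G E sets by (intro measure_Un_le) auto
  ultimately show ?thesis
    using sample_ratio_tail[OF x \<open>0 < \<nu>\<close> \<open>1 < \<tau>\<close>, of n] by linarith
qed

lemma exp_5_gt_64: "64 < exp (5 :: real)"
proof -
  have "5 / 2 \<le> exp (1 :: real)"
    using exp_lower_Taylor_quadratic[of 1] by simp
  then have "(5 / 2) ^ 5 \<le> exp (1 :: real) ^ 5"
    by (intro power_mono) auto
  also have "exp (1 :: real) ^ 5 = exp 5"
    by (simp flip: exp_of_nat_mult)
  finally show ?thesis by (simp add: power_divide)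
qed

text \<open>If every point were recognised with probability above 4/5, summing the change of measure
  with threshold \<open>sqrt N\<close> over the disjoint regions would give (4/5) N \<le>
  \<open>sqrt N\<close> + (13/20) N, false for N above 64.\<close>

lemma packing_test_error:
  assumes S: "finite S" "5 \<le> ln (real (card S))" and x: "\<And>x. x \<in> S \<Longrightarrow> (\<Sum>i<p. (x i)\<^sup>2) = 1"
    and "0 < \<nu>" and n: "n * min \<nu> (\<nu>\<^sup>2) \<le> ln (real (card S)) / 4"
    and A: "\<And>x. x \<in> S \<Longrightarrow> A x \<in> sets (null_sample_law p n)" "disjoint_family_on A S"
  shows "\<exists>x\<in>S. measure (sample_law p n \<nu> x) (A x) \<le> 4 / 5"
proof (rule ccontr)
  assume "\<not> ?thesis"
  then have large: "\<And>x. x \<in> S \<Longrightarrow> 4 / 5 \<le> measure (sample_law p n \<nu> x) (A x)" by force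
  interpret Q: prob_space "null_sample_law p n" by (rule prob_space_null_sample_law)
  define N where "N = real (card S)"
  have "0 < N" using S(2) by (cases "card S = 0") (auto simp: N_def)
  have "exp 5 \<le> N"
    using S(2) \<open>0 < N\<close> by (metis N_def exp_le_cancel_iff exp_ln)
  then have "64 < N" using exp_5_gt_64 by linarith
  have ln: "ln (sqrt N) = ln N / 2" using \<open>0 < N\<close> by (simp add: ln_sqrt)
  \<comment> \<open>With C at most ln N / 4, the quotient is at most (ln N / 8 + 1) / (ln N / 2) =
    1/4 + 2 / ln N, and ln N is at least 5.\<close>
  have tail: "(n * min \<nu> (\<nu>\<^sup>2) / 2 + 1) / ln (sqrt N) \<le> 13 / 20"
    using n S(2) unfolding ln N_def[symmetric] by (simp add: field_simps)
  have "4 / 5 * N = (\<Sum>x\<in>S. 4 / 5)" by (simp add: N_def)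
  also have "\<dots> \<le> (\<Sum>x\<in>S. sqrt N * measure (null_sample_law p n) (A x) + 13 / 20)"
  proof (rule sum_mono)
    fix x assume "x \<in> S"
    have "measure (sample_law p n \<nu> x) (A x)
        \<le> sqrt N * measure (null_sample_law p n) (A x) + (n * min \<nu> (\<nu>\<^sup>2) / 2 + 1) / ln (sqrt N)"
      using \<open>x \<in> S\<close> \<open>64 < N\<close> by (intro sample_law_change_of_measure x A \<open>0 < \<nu>\<close>) auto
    with large[OF \<open>x \<in> S\<close>] tail
    show "4 / 5 \<le> sqrt N * measure (null_sample_law p n) (A x) + 13 / 20" by linarith
  qed
  also have "\<dots> = sqrt N * measure (null_sample_law p n) (\<Union>x\<in>S. A x) + 13 / 20 * N"
    using S(1) A by (subst Q.finite_measure_finite_Union)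
      (auto simp: sum.distrib sum_distrib_left N_def)
  also have "\<dots> \<le> sqrt N * 1 + 13 / 20 * N"
    using \<open>0 < N\<close> by (intro add_mono mult_left_mono) auto
  finally have "3 / 20 * N \<le> sqrt N" by simp
  moreover have "sqrt N * 8 < sqrt N * sqrt N"
    using \<open>64 < N\<close> real_less_rsqrt[of 8 N] by (intro mult_strict_left_mono) auto
  ultimately show False using \<open>0 < N\<close> by simp
qed

text \<open>An estimator yields a test: the events of lying strictly within \<epsilon>/2 of a
  packing point are disjoint. Some point is missed with probability at least 1/5 and then loses at
  least \<epsilon>/2, hence \<epsilon>/10.\<close>

lemma minimax_risk_ge_packing:
  assumes S: "finite S" "5 \<le> ln (real (card S))" "separated p \<epsilon> S" "S \<subseteq> T"
    and T: "T \<subseteq> unit_sphere p"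
    and "0 < \<epsilon>" and "0 < \<nu>" and n: "n * min \<nu> (\<nu>\<^sup>2) \<le> ln (real (card S)) / 4"
  shows "ennreal (\<epsilon> / 10) \<le> minimax_risk p n \<nu> T"
  unfolding minimax_risk_def
proof (rule INF_greatest)
  fix v assume "v \<in> estimators p n"
  then have v: "v \<in> null_sample_law p n \<rightarrow>\<^sub>M Rn p"
    by (simp add: estimators_def measurable_cong_sets[OF sets_null_sample_law])
  have x: "(\<Sum>i<p. (x i)\<^sup>2) = 1" if "x \<in> S" for x
    using that S(4) T by (auto simp: unit_sphere_def L2_set_def)
  let ?d = "\<lambda>x X. L2_set (\<lambda>i. v X i - x i) {..<p}"
  define A where "A x = {X \<in> space (null_sample_law p n). ?d x X < \<epsilon> / 2}" for x
  have meas: "?d x \<in> borel_measurable (null_sample_law p n)" for x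
  proof -
    have "(\<lambda>X. \<Sum>i<p. (v X i - x i)\<^sup>2) \<in> borel_measurable (null_sample_law p n)"
      by (intro borel_measurable_sum borel_measurable_power borel_measurable_diff
          measurable_compose[OF v measurable_Rn_component]) auto
    then show ?thesis unfolding L2_set_def by measurable
  qed
  have A: "A x \<in> sets (null_sample_law p n)" for x
    using meas unfolding A_def by measurable
  have "disjoint_family_on A S"
    unfolding disjoint_family_on_def
  proof (intro ballI impI, rule ccontr)
    fix x y assume xy: "x \<in> S" "y \<in> S" "x \<noteq> y" and "A x \<inter> A y \<noteq> {}"
    then obtain X where "?d x X < \<epsilon> / 2" "?d y X < \<epsilon> / 2" by (auto simp: A_def)
    moreover have "L2_set (\<lambda>i. x i - y i) {..<p} \<le> L2_set (\<lambda>i. x i - v X i) {..<p} + ?d y X"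
      using L2_set_triangle_ineq[of "\<lambda>i. x i - v X i" "\<lambda>i. v X i - y i"] by simp
    moreover have "L2_set (\<lambda>i. x i - v X i) {..<p} = ?d x X"
      by (simp add: L2_set_def power2_commute)
    moreover have "\<epsilon> \<le> L2_set (\<lambda>i. x i - y i) {..<p}"
      using S(3) xy by (auto simp: separated_def)
    ultimately show False by linarith
  qed
  with packing_test_error[OF S(1,2) x \<open>0 < \<nu>\<close> n, of A] A obtain y where y: "y \<in> S"
    "measure (sample_law p n \<nu> y) (A y) \<le> 4 / 5" by blast
  let ?P = "sample_law p n \<nu> y"
  have "0 \<le> \<nu>" using \<open>0 < \<nu>\<close> by simp
  interpret P: prob_space ?P by (rule prob_space_sample_law[OF x[OF y(1)] \<open>0 \<le> \<nu>\<close>])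
  have sets: "sets ?P = sets (null_sample_law p n)"
    by (simp add: sample_law_eq_density[OF x[OF y(1)] \<open>0 \<le> \<nu>\<close>])
  have space: "space ?P = space (null_sample_law p n)" by (rule sets_eq_imp_space_eq[OF sets])
  have "measure ?P (space ?P - A y) = 1 - measure ?P (A y)"
    using A sets by (intro P.prob_compl) auto
  with y have compl: "1 / 5 \<le> measure ?P (space ?P - A y)" by simp
  have "ennreal (\<epsilon> / 10) \<le> ennreal (\<epsilon> / 2) * emeasure ?P (space ?P - A y)"
    using compl \<open>0 < \<epsilon>\<close> by (simp add: P.emeasure_eq_measure flip: ennreal_mult)
  also have "\<dots> = (\<integral>\<^sup>+X. ennreal (\<epsilon> / 2) * indicator (space ?P - A y) X \<partial>?P)"
    using A sets by (intro nn_integral_cmult_indicator[symmetric]) auto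
  also have "\<dots> \<le> (\<integral>\<^sup>+X. ennreal (?d y X) \<partial>?P)"
    using space by (intro nn_integral_mono) (auto simp: A_def indicator_def intro!: ennreal_leI)
  also have "\<dots> \<le> (SUP x\<in>T. \<integral>\<^sup>+X. ennreal (?d x X) \<partial>sample_law p n \<nu> x)"
    using y S(4) by (intro SUP_upper) auto
  finally show "ennreal (\<epsilon> / 10) \<le> (SUP x\<in>T. \<integral>\<^sup>+X. ennreal (?d x X) \<partial>sample_law p n \<nu> x)" .
qed

section \<open>The minimax bound\<close>

lemma min_sqrt_mult_sqrt:
  fixes a \<nu> :: real
  assumes "0 < \<nu>"
  shows "min \<nu> (sqrt \<nu>) * sqrt a = sqrt (a * min \<nu> (\<nu>\<^sup>2))"
proof (cases "\<nu> \<le> 1")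
  case True
  then have "\<nu>\<^sup>2 \<le> \<nu>" using assms by (simp add: power2_eq_square)
  moreover from this have "\<nu> \<le> sqrt \<nu>" using assms by (intro real_le_rsqrt) auto
  ultimately show ?thesis
    using assms by (simp add: min_absorb1 min_absorb2 real_sqrt_mult)
next
  case False
  then have "\<nu> \<le> \<nu>\<^sup>2" using assms by (simp add: power2_eq_square)
  moreover from this have "sqrt \<nu> \<le> \<nu>" using assms by (intro real_le_lsqrt) auto
  ultimately show ?thesis
    using assms by (simp add: min_absorb1 min_absorb2 real_sqrt_mult)
qed

lemma exists_good_packing:
  assumes T: "T \<subseteq> unit_sphere p" and w: "64 \<le> gaussian_complexity p T"
  obtains \<epsilon> S where "0 < \<epsilon>" "finite S" "S \<subseteq> T" "separated p \<epsilon> S" "5 \<le> ln (real (card S))"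
    "gaussian_complexity p T / (32 * ln (real p)) \<le> \<epsilon> * sqrt (min (ln (real (card S)) / 4) (8 * real p))"
    "0 < p" "0 < ln (real p)"
proof -
  define w where "w = gaussian_complexity p T"
  have "64 \<le> w" using w by (simp add: w_def)
  have "T \<noteq> {}" using w by (auto simp: gaussian_complexity_def)
  then obtain t where "t \<in> T" by blast
  have norm: "L2_set x {..<p} = 1" if "x \<in> T" for x
    using that T by (auto simp: unit_sphere_def)
  have "0 < p" using norm[OF \<open>t \<in> T\<close>] by (cases "p = 0") auto
  \<comment> \<open>A one-point net of radius 2 shows that \<open>w\<close> is at most
    \<open>2 * sqrt p\<close>. A large \<open>w\<close> thus forces a large \<open>p\<close>, which
    makes \<open>ln p\<close> at least 1.\<close>
  have "w \<le> finite_width p {t} + 2 * sqrt p"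
    unfolding w_def
  proof (rule gaussian_complexity_le_net)
    fix x assume "x \<in> T"
    have "L2_set (\<lambda>i. - t i) {..<p} = L2_set t {..<p}" by (simp add: L2_set_def)
    then have "L2_set (\<lambda>i. x i - t i) {..<p} \<le> 2"
      using L2_set_triangle_ineq[of x "\<lambda>i. - t i" "{..<p}"] norm[OF \<open>x \<in> T\<close>] norm[OF \<open>t \<in> T\<close>]
      by simp
    then show "\<exists>s\<in>{t}. L2_set (\<lambda>i. x i - s i) {..<p} \<le> 2" by simp
  qed (use w \<open>T \<noteq> {}\<close> \<open>0 < p\<close> in auto)
  also have "finite_width p {t} = 0"
    by (simp add: finite_width_def has_bochner_integral_integral_eq[OF std_gaussian_inner_mean])
  finally have "2 \<le> sqrt p" using \<open>64 \<le> w\<close> by simp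
  then have "2\<^sup>2 \<le> (sqrt p)\<^sup>2" by (intro power_mono) auto
  then have "4 \<le> real p" by simp
  have "1 \<le> ln (real p)"
    using \<open>4 \<le> real p\<close> exp_le by (subst ln_ge_iff) auto
  \<comment> \<open>The number of halvings after which the radius times \<open>sqrt p\<close> is at
    most 2; it is at most \<open>2 * ln p\<close>.\<close>
  define L where "L = nat \<lceil>log 2 (sqrt p)\<rceil>"
  have "0 \<le> log 2 (sqrt p)"
    using \<open>2 \<le> sqrt p\<close> by (subst zero_le_log_cancel_iff) linarith+
  then have L: "log 2 (sqrt p) \<le> real L" "real L \<le> log 2 (sqrt p) + 1"
    unfolding L_def by linarith+
  have "sqrt p = 2 powr log 2 (sqrt p)"
    using \<open>2 \<le> sqrt p\<close> by (intro powr_log_cancel[symmetric]) linarith+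
  also have "\<dots> \<le> 2 powr real L" using L by (intro powr_mono) auto
  finally have "sqrt p \<le> 2 ^ L" by (simp add: powr_realpow)
  then have top: "2 / 2 ^ L * sqrt p \<le> 2" by (simp add: field_simps)
  have "log 2 (sqrt p) = ln p / (2 * ln 2)"
    using \<open>0 < p\<close> by (simp add: log_def ln_sqrt)
  also have "\<dots> \<le> ln p / 1"
    using ln2_ge_two_thirds \<open>1 \<le> ln (real p)\<close> by (intro divide_left_mono) auto
  finally have L_le: "real L \<le> 2 * ln p" using L(2) \<open>1 \<le> ln (real p)\<close> by simp
  define \<delta> where "\<delta> = w / (32 * ln p)"
  have "0 < \<delta>" using \<open>64 \<le> w\<close> \<open>1 \<le> ln (real p)\<close> by (simp add: \<delta>_def)
  have \<delta>: "ln p * \<delta> = w / 32" using \<open>1 \<le> ln (real p)\<close> by (simp add: \<delta>_def)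
  have "\<exists>k S. finite S \<and> S \<subseteq> T \<and> separated p (2 / 2 ^ k) S \<and> 5 \<le> ln (real (card S))
      \<and> \<delta> \<le> 2 / 2 ^ k * sqrt (min (ln (real (card S)) / 4) (8 * real p))"
  proof (rule ccontr)
    assume none: "\<not> ?thesis"
    have "w \<le> 13 + 6 * real L * \<delta> + 2 * \<delta> + 2 / 2 ^ L * sqrt p"
      unfolding w_def
    proof (rule gaussian_complexity_le_packing)
      fix k S
      assume "finite S" "S \<subseteq> T" "separated p (2 / 2 ^ k) S" "5 \<le> ln (real (card S))"
      then show "2 / 2 ^ k * sqrt (min (ln (real (card S)) / 4) (8 * real p)) < \<delta>"
        using none not_le by blast
    qed (use norm \<open>0 < p\<close> \<open>0 < \<delta>\<close> \<open>T \<noteq> {}\<close> w in auto)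
    moreover have "6 * real L * \<delta> \<le> 6 * (2 * ln p) * \<delta>"
      using L_le \<open>0 < \<delta>\<close> by (intro mult_right_mono mult_left_mono) auto
    moreover have "6 * (2 * ln p) * \<delta> = 12 * (ln p * \<delta>)" by simp
    moreover have "1 * \<delta> \<le> ln p * \<delta>"
      using \<open>1 \<le> ln (real p)\<close> \<open>0 < \<delta>\<close> by (intro mult_right_mono) auto
    \<comment> \<open>The chaining bound totals at most 13 + 12 w/32 + 2 w/32 + 2 = 15 + 14 w/32,
      which is below \<open>w\<close> once \<open>w\<close> is at least 64. This is why \<delta>
      carries the factor 32.\<close>
    ultimately show False
      using top \<delta> \<open>64 \<le> w\<close> by linarith
  qed
  then obtain k S where "finite S" "S \<subseteq> T" "separated p (2 / 2 ^ k) S" "5 \<le> ln (real (card S))"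
      "\<delta> \<le> 2 / 2 ^ k * sqrt (min (ln (real (card S)) / 4) (8 * real p))"
    by blast
  then show thesis
    using \<open>0 < p\<close> \<open>4 \<le> real p\<close>
    by (intro that[of "2 / 2 ^ k" S]) (simp_all add: \<delta>_def w_def)
qed

theorem theorem5p1:
  shows "\<exists>c>0. \<forall>(p::nat) K.
    convex_cone_Rn p K \<and>
    gaussian_complexity p (K \<inter> unit_sphere p) \<ge> 64 * sqrt (ln 3) \<longrightarrow>
    (\<exists>C::real. 0 < C \<and> C \<le> 8 * real p \<and>
      (\<forall>(n::nat) (\<nu>::real). 0 < n \<and> 0 < \<nu> \<and> real n * min \<nu> (\<nu>\<^sup>2) = C \<longrightarrow>
        minimax_risk p n \<nu> (K \<inter> unit_sphere p) \<ge>
          ennreal (c * gaussian_complexity p (K \<inter> unit_sphere p)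
            / (ln (real p) * min \<nu> (sqrt \<nu>) * sqrt (real n)))))"
proof (rule exI[of _ "1 / 320"], intro conjI allI impI)
  fix p :: nat and K
  assume "convex_cone_Rn p K \<and> gaussian_complexity p (K \<inter> unit_sphere p) \<ge> 64 * sqrt (ln 3)"
  then have w: "gaussian_complexity p (K \<inter> unit_sphere p) \<ge> 64 * sqrt (ln 3)" ..
  define T where "T = K \<inter> unit_sphere p"
  define w where "w = gaussian_complexity p T"
  \<comment> \<open>Since e is at most 3, the threshold \<open>64 * sqrt (ln 3)\<close> is at least
    64.\<close>
  have "1 \<le> ln (3 :: real)" using exp_le by (subst ln_ge_iff) auto
  then have "1 \<le> sqrt (ln (3 :: real))" by simp
  then have w64: "64 \<le> gaussian_complexity p T"
    using w unfolding T_def by linarith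
  obtain \<epsilon> S where S: "0 < \<epsilon>" "finite S" "S \<subseteq> T" "separated p \<epsilon> S" "5 \<le> ln (real (card S))"
    and good: "w / (32 * ln (real p)) \<le> \<epsilon> * sqrt (min (ln (real (card S)) / 4) (8 * real p))"
    and p: "0 < p" "0 < ln (real p)"
    using exists_good_packing[OF _ w64] unfolding w_def T_def by blast
  \<comment> \<open>Fixed by the packing before \<open>n\<close> and \<nu> appear, so it depends on
    \<open>K\<close> and its ambient dimension alone. The cap only lowers it, so the testing bound
    still applies.\<close>
  define C where "C = min (ln (real (card S)) / 4) (8 * real p)"
  have "0 < C" "C \<le> 8 * real p" "C \<le> ln (real (card S)) / 4"
    using S(5) p by (auto simp: C_def)
  show "\<exists>C::real. 0 < C \<and> C \<le> 8 * real p \<and>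
      (\<forall>(n::nat) (\<nu>::real). 0 < n \<and> 0 < \<nu> \<and> real n * min \<nu> (\<nu>\<^sup>2) = C \<longrightarrow>
        minimax_risk p n \<nu> (K \<inter> unit_sphere p) \<ge>
          ennreal (1 / 320 * gaussian_complexity p (K \<inter> unit_sphere p)
            / (ln (real p) * min \<nu> (sqrt \<nu>) * sqrt (real n))))"
  proof (intro exI[of _ C] conjI allI impI)
    fix n :: nat and \<nu> :: real
    assume "0 < n \<and> 0 < \<nu> \<and> real n * min \<nu> (\<nu>\<^sup>2) = C"
    then have "0 < \<nu>" and C: "real n * min \<nu> (\<nu>\<^sup>2) = C" by auto
    have rate: "ln (real p) * min \<nu> (sqrt \<nu>) * sqrt (real n) = ln (real p) * sqrt C"
      using min_sqrt_mult_sqrt[OF \<open>0 < \<nu>\<close>, of "real n"] by (simp add: C mult.assoc)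
    \<comment> \<open>The constant is 1/10 from the risk bound times 1/32 from the good
      packing.\<close>
    have "1 / 320 * w / (ln (real p) * sqrt C) \<le> \<epsilon> / 10"
      using good[folded C_def] p \<open>0 < C\<close> by (simp add: field_simps)
    then have "ennreal (1 / 320 * w / (ln (real p) * sqrt C)) \<le> ennreal (\<epsilon> / 10)"
      by (rule ennreal_leI)
    also have "\<dots> \<le> minimax_risk p n \<nu> T"
      using S \<open>0 < \<nu>\<close> C \<open>C \<le> ln (real (card S)) / 4\<close>
      by (intro minimax_risk_ge_packing[of S]) (auto simp: T_def)
    finally show "minimax_risk p n \<nu> (K \<inter> unit_sphere p) \<ge>
        ennreal (1 / 320 * gaussian_complexity p (K \<inter> unit_sphere p)
          / (ln (real p) * min \<nu> (sqrt \<nu>) * sqrt (real n)))"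
      unfolding rate w_def T_def .
  qed fact+
qed simp

end
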